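(* Let $f$, $P_1$, $P_2$, $P=P_1-P_2$, $F=f+P$ and $L>0$ satisfy the standing assumptions given in the context (in particular $F$ is level-bounded). Let $\mathcal{X}$ be the set of stationary points of $F$, and suppose that $P_2$ is continuously differentiable on an open set $\mathcal{N}_0$ containing $\mathcal{X}$ and that $\nabla P_2$ is locally Lipschitz continuous on $\mathcal{N}_0$. Suppose also that the function $$E(x,y)=f(x)+P(x)+\frac{L}{2}\|x-y\|^2,\qquad (x,y)\in\mathbb{R}^n\times\mathbb{R}^n,$$ is a KL function. Let $\{x^t\}$ be a sequence generated by ${\rm pDCA}_e$ (defined in the context) for solving $\min_{x\in\mathbb{R}^n}F(x)$, let $\Omega$ be the set of accumulation points of $\{x^t\}$, and let $\zeta:=\lim_{t\to\infty}F(x^t)$ (this limit exists). Then the following statements hold. (i) $\lim_{t\to\infty}\mathrm{dist}((0,0),\partial E(x^t,x^{t-1}))=0$. (ii) The sequence $\{E(x^t,x^{t-1})\}$ is nonincreasing and $\lim_{t\to\infty}E(x^t,x^{t-1})=\zeta$. (iii) The set of accumulation points of $\{(x^t,x^{t-1})\}$ is $\Upsilon:=\{(x,x): x\in\Omega\}$, and $E\equiv\zeta$ on $\Upsilon$. (iv) The sequence $\{x^t\}$ converges to a stationary point of $F$; moreover, $\sum_{t=1}^\infty\|x^t-x^{t-1}\|<\infty$.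
   Context: Notation: $\mathbb{R}^n$ carries the inner product $\langle\cdot,\cdot\rangle$ and Euclidean norm $\|\cdot\|$. For an extended-real-valued function $h$, $\mathrm{dom}\,h=\{x: h(x)<\infty\}$; $h$ is proper if it never equals $-\infty$ and $\mathrm{dom}\,h\neq\emptyset$; a proper function is closed if it is lower semicontinuous; a proper closed $h$ is level-bounded if $\{x: h(x)\le r\}$ is bounded for every $r\in\mathbb{R}$. $\mathrm{dist}(x,C)=\inf_{y\in C}\|x-y\|$ (equal to $+\infty$ if $C=\emptyset$). Subdifferential: for a proper closed $h$ and $x\in\mathrm{dom}\,h$, $\partial h(x)$ is the limiting subdifferential, i.e. the set of $v$ for which there exist $x^k\to x$ with $h(x^k)\to h(x)$ and $v^k\to v$ such that $\liminf_{y\to x^k,\,y\ne x^k}\frac{h(y)-h(x^k)-\langle v^k,y-x^k\rangle}{\|y-x^k\|}\ge 0$ for each $k$. For convex $h$ it equals $\{v: h(u)-h(x)-\langle v,u-x\rangle\ge0\ \forall u\}$. $\mathrm{dom}\,\partial h=\{x:\partial h(x)\neq\emptyset\}$. KL property: a proper closed function $h$ satisfies the KL property at $\hat x\in\mathrm{dom}\,\partial h$ if there exist $a\in(0,\infty]$, a neighborhood $\mathcal{O}$ of $\hat x$ and a continuous concave function $\phi:[0,a)\to[0,\infty)$ with $\phi(0)=0$ such that $\phi$ is continuously differentiable on $(0,a)$ with $\phi'>0$, and $\phi'(h(x)-h(\hat x))\,\mathrm{dist}(0,\partial h(x))\ge 1$ for every $x\in\mathcal{O}$ with $h(\hat x)<h(x)<h(\hat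 x)+a$. A proper closed function satisfying the KL property at all points of $\mathrm{dom}\,\partial h$ is called a KL function. Standing assumptions: $F(x)=f(x)+P(x)$ with $P(x)=P_1(x)-P_2(x)$, where $f:\mathbb{R}^n\to\mathbb{R}$ is a smooth convex function whose gradient is Lipschitz continuous with modulus $L>0$, $P_1:\mathbb{R}^n\to(-\infty,\infty]$ is proper closed convex, $P_2:\mathbb{R}^n\to\mathbb{R}$ is a continuous convex function, and $F$ is level-bounded. Algorithm ${\rm pDCA}_e$ (proximal difference-of-convex algorithm with extrapolation): the input is $x^0\in\mathrm{dom}\,P_1$ and $\{\beta_t\}\subseteq[0,1)$ with $\sup_t\beta_t<1$. Set $x^{-1}=x^0$. For $t=0,1,2,\dots$, take any $\xi^t\in\partial P_2(x^t)$ and set $$y^t=x^t+\beta_t(x^t-x^{t-1}),\qquad x^{t+1}=\operatorname{arg\,min}_{y\in\mathbb{R}^n}\Big\{\langle\nabla f(y^t)-\xi^t,y\rangle+\tfrac{L}{2}\|y-y^t\|^2+P_1(y)\Big\}.$$ Stationary point: $\bar x$ is a stationary point of $F$ if $0\in\nabla f(\bar x)+\partial P_1(\bar x)-\partial P_2(\bar x)$ (Minkowski sum and difference of sets); $\mathcal{X}$ denotes the set of all stationary points of $F$. *)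

theory Defs
  imports "HOL-Analysis.Analysis"
begin

section \<open>Extended-real-valued functions\<close>

definition dom_fun :: "('a \<Rightarrow> ereal) \<Rightarrow> 'a set" where
  "dom_fun h = {x. h x < \<infinity>}"

definition proper_fun :: "('a \<Rightarrow> ereal) \<Rightarrow> bool" where
  "proper_fun h \<longleftrightarrow> (\<forall>x. h x \<noteq> -\<infinity>) \<and> dom_fun h \<noteq> {}"

definition closed_fun :: "('a::topological_space \<Rightarrow> ereal) \<Rightarrow> bool" where
  "closed_fun h \<longleftrightarrow> (\<forall>x. h x \<le> Liminf (at x) h)"

text \<open>Only used for functions that never take the value \<open>-\<infinity>\<close>, so that no sum
  \<open>\<infinity> + -\<infinity>\<close> occurs; at the end points of the unit interval \<open>0 * \<infinity> = 0\<close>.\<close>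

definition convex_fun :: "('a::real_vector \<Rightarrow> ereal) \<Rightarrow> bool" where
  "convex_fun h \<longleftrightarrow>
     (\<forall>x y. \<forall>u\<in>{0..1::real}.
        h ((1 - u) *\<^sub>R x + u *\<^sub>R y) \<le> ereal (1 - u) * h x + ereal u * h y)"

definition level_bounded :: "('a::metric_space \<Rightarrow> ereal) \<Rightarrow> bool" where
  "level_bounded h \<longleftrightarrow>
     proper_fun h \<and> closed_fun h \<and> (\<forall>r::real. bounded {x. h x \<le> ereal r})"

text \<open>Unlike \<^const>\<open>infdist\<close>, the distance to the empty set is \<open>\<infinity>\<close>.\<close>

definition edist :: "'a::metric_space \<Rightarrow> 'a set \<Rightarrow> ereal" where
  "edist x C = (INF y\<in>C. ereal (dist x y))"


section \<open>Subdifferential\<close>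

definition frechet_subdiff :: "('a::real_inner \<Rightarrow> ereal) \<Rightarrow> 'a \<Rightarrow> 'a set" where
  "frechet_subdiff h x =
     {v. \<bar>h x\<bar> \<noteq> \<infinity> \<and>
         0 \<le> Liminf (at x) (\<lambda>y. (h y - h x - ereal (inner v (y - x))) / ereal (norm (y - x)))}"

definition subdiff :: "('a::real_inner \<Rightarrow> ereal) \<Rightarrow> 'a \<Rightarrow> 'a set" where
  "subdiff h x =
     {v. x \<in> dom_fun h \<and>
         (\<exists>xs vs. xs \<longlonglongrightarrow> x \<and> (\<lambda>k. h (xs k)) \<longlonglongrightarrow> h x \<and> vs \<longlonglongrightarrow> v \<and>
                  (\<forall>k::nat. vs k \<in> frechet_subdiff h (xs k)))}"

definition dom_subdiff :: "('a::real_inner \<Rightarrow> ereal) \<Rightarrow> 'a set" where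
  "dom_subdiff h = {x. subdiff h x \<noteq> {}}"


section \<open>Kurdyka--Lojasiewicz property\<close>

definition KL_property_at :: "('a::real_inner \<Rightarrow> ereal) \<Rightarrow> 'a \<Rightarrow> bool" where
  "KL_property_at h z \<longleftrightarrow>
     (\<exists>(a::ereal) U (\<phi>::real \<Rightarrow> real) \<phi>'.
        0 < a \<and> open U \<and> z \<in> U \<and>
        continuous_on {s. 0 \<le> s \<and> ereal s < a} \<phi> \<and>
        concave_on {s. 0 \<le> s \<and> ereal s < a} \<phi> \<and>
        (\<forall>s. 0 \<le> s \<and> ereal s < a \<longrightarrow> 0 \<le> \<phi> s) \<and>
        \<phi> 0 = 0 \<and>
        (\<forall>s. 0 < s \<and> ereal s < a \<longrightarrow> (\<phi> has_real_derivative \<phi>' s) (at s)) \<and>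
        continuous_on {s. 0 < s \<and> ereal s < a} \<phi>' \<and>
        (\<forall>s. 0 < s \<and> ereal s < a \<longrightarrow> 0 < \<phi>' s) \<and>
        (\<forall>x\<in>U. h z < h x \<and> h x < h z + a \<longrightarrow>
           1 \<le> ereal (\<phi>' (real_of_ereal (h x - h z))) * edist 0 (subdiff h x)))"

definition KL_function :: "('a::real_inner \<Rightarrow> ereal) \<Rightarrow> bool" where
  "KL_function h \<longleftrightarrow>
     proper_fun h \<and> closed_fun h \<and> (\<forall>z\<in>dom_subdiff h. KL_property_at h z)"


section \<open>Gradients\<close>

definition grad :: "('a::real_inner \<Rightarrow> real) \<Rightarrow> 'a \<Rightarrow> 'a" where
  "grad f x = (THE v. GDERIV f x :> v)"

lemma grad_eqI:
  assumes "GDERIV f x :> v"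
  shows "grad f x = v"
  unfolding grad_def
proof (rule the_equality)
  fix w assume "GDERIV f x :> w"
  then have "(\<lambda>h. inner h w) = (\<lambda>h. inner h v)"
    using assms unfolding gderiv_def by (rule has_derivative_unique)
  then have "inner (w - v) w = inner (w - v) v"
    by (rule fun_cong)
  then have "inner (w - v) (w - v) = 0"
    by (simp add: inner_diff_right)
  then show "w = v"
    by simp
qed (fact assms)

lemma GDERIV_grad:
  fixes f :: "'a::euclidean_space \<Rightarrow> real"
  assumes "f differentiable (at x)"
  shows "GDERIV f x :> grad f x"
proof -
  obtain D where D: "(f has_derivative D) (at x)"
    using assms unfolding differentiable_def by blast
  then interpret bounded_linear D
    by (rule has_derivative_bounded_linear)
  have "D h = inner h (\<Sum>b\<in>Basis. D b *\<^sub>R b)" for h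
  proof -
    have "D h = D (\<Sum>b\<in>Basis. inner h b *\<^sub>R b)"
      by (simp add: euclidean_representation)
    also have "\<dots> = (\<Sum>b\<in>Basis. inner h b * D b)"
      by (simp add: sum scaleR)
    also have "\<dots> = inner h (\<Sum>b\<in>Basis. D b *\<^sub>R b)"
      by (simp add: inner_sum_right mult.commute)
    finally show ?thesis .
  qed
  then have "D = (\<lambda>h. inner h (\<Sum>b\<in>Basis. D b *\<^sub>R b))"
    by (rule ext)
  with D have "GDERIV f x :> (\<Sum>b\<in>Basis. D b *\<^sub>R b)"
    unfolding gderiv_def by (rule has_derivative_eq_rhs)
  from this grad_eqI[OF this] show ?thesis
    by (simp only:)
qed

definition continuously_differentiable_on ::
    "('a::real_inner \<Rightarrow> real) \<Rightarrow> 'a set \<Rightarrow> bool" where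
  "continuously_differentiable_on f N \<longleftrightarrow>
     (\<forall>x\<in>N. f differentiable (at x)) \<and> continuous_on N (grad f)"

definition locally_lipschitz_on ::
    "'a set \<Rightarrow> ('a::metric_space \<Rightarrow> 'b::metric_space) \<Rightarrow> bool" where
  "locally_lipschitz_on N g \<longleftrightarrow>
     (\<forall>x\<in>N. \<exists>u>0. \<exists>C. C-lipschitz_on (ball x u \<inter> N) g)"


section \<open>The difference-of-convex problem and the algorithm\<close>

definition objective_F ::
    "('a \<Rightarrow> real) \<Rightarrow> ('a \<Rightarrow> ereal) \<Rightarrow> ('a \<Rightarrow> real) \<Rightarrow> 'a \<Rightarrow> ereal" where
  "objective_F f P1 P2 x = ereal (f x) + (P1 x - ereal (P2 x))"

definition objective_E ::
    "('a::real_inner \<Rightarrow> real) \<Rightarrow> ('a \<Rightarrow> ereal) \<Rightarrow> ('a \<Rightarrow> real) \<Rightarrow> real \<Rightarrow> 'a \<times> 'a \<Rightarrow> ereal" where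
  "objective_E f P1 P2 L = (\<lambda>(x, y).
     ereal (f x) + (P1 x - ereal (P2 x)) + ereal (L / 2 * (norm (x - y))\<^sup>2))"

definition stationary_points ::
    "('a::real_inner \<Rightarrow> real) \<Rightarrow> ('a \<Rightarrow> ereal) \<Rightarrow> ('a \<Rightarrow> real) \<Rightarrow> 'a set" where
  "stationary_points f P1 P2 =
     {x. 0 \<in> {grad f x + u - w | u w. u \<in> subdiff P1 x \<and> w \<in> subdiff (\<lambda>z. ereal (P2 z)) x}}"

text \<open>Sequences start at index 0. Since subtraction of natural numbers is truncated,
  \<open>x (t - 1)\<close> is \<open>x 0\<close> for \<open>t = 0\<close>, which is the convention \<open>x\<^sup>-\<^sup>1 = x\<^sup>0\<close>.\<close>

definition pDCAe_sequence ::
    "('a::real_inner \<Rightarrow> real) \<Rightarrow> ('a \<Rightarrow> ereal) \<Rightarrow> ('a \<Rightarrow> real) \<Rightarrow> real \<Rightarrow>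
     (nat \<Rightarrow> real) \<Rightarrow> (nat \<Rightarrow> 'a) \<Rightarrow> bool" where
  "pDCAe_sequence f P1 P2 L \<beta> x \<longleftrightarrow>
     x 0 \<in> dom_fun P1 \<and> (\<forall>t. 0 \<le> \<beta> t \<and> \<beta> t < 1) \<and> (SUP t. \<beta> t) < 1 \<and>
     (\<forall>t. \<exists>\<xi>\<in>subdiff (\<lambda>z. ereal (P2 z)) (x t).
        let y = x t + \<beta> t *\<^sub>R (x t - x (t - 1)) in
        is_arg_min
          (\<lambda>z. ereal (inner (grad f y - \<xi>) z + L / 2 * (norm (z - y))\<^sup>2) + P1 z)
          (\<lambda>z. True) (x (Suc t)))"

definition accumulation_points :: "(nat \<Rightarrow> 'a::topological_space) \<Rightarrow> 'a set" where
  "accumulation_points x = {l. \<exists>r. strict_mono r \<and> (x \<circ> r) \<longlonglongrightarrow> l}"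

end

theory Submission
  imports Defs
begin

text \<open>The prox step, the descent lemma for \<open>f\<close> and the subgradient inequality for \<open>P2\<close> show that
  \<open>E (x\<^sup>t, x\<^sup>t\<^sup>-\<^sup>1)\<close> decreases by at least a multiple of \<open>\<parallel>x\<^sup>t - x\<^sup>t\<^sup>-\<^sup>1\<parallel>\<^sup>2\<close>; hence it converges and
  the increments tend to 0. Passing to the limit in the optimality condition of the prox step
  shows that every cluster point is stationary and has the limiting value \<open>\<zeta>\<close>. Near a cluster point
  \<open>z\<close>, \<open>P2\<close> has a Lipschitz gradient, so \<open>E\<close> has a subgradient at \<open>(x\<^sup>t, x\<^sup>t\<^sup>-\<^sup>1)\<close> bounded by
  \<open>\<parallel>x\<^sup>t - x\<^sup>t\<^sup>-\<^sup>1\<parallel> + \<parallel>x\<^sup>t\<^sup>-\<^sup>1 - x\<^sup>t\<^sup>-\<^sup>2\<parallel>\<close> up to a constant. The Kurdyka--Lojasiewicz inequality at the single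
  point \<open>(z, z)\<close> then bounds the length of the trajectory and traps it near \<open>z\<close>. No uniform version
  of the inequality over all cluster points is needed: after \<open>x\<^sup>t \<rightarrow> z\<close> is known, (i) is local
  at \<open>z\<close>.\<close>

section \<open>Lower semicontinuity along sequences and the distance to a set\<close>

text \<open>\<open>closed_fun\<close> uses a punctured Liminf. A bound \<open>b < h z\<close> holds
  at \<open>z\<close> as well, so it extends to \<open>nhds z\<close> and the sequence may hit
  \<open>z\<close>.\<close>

lemma closed_funD_sequentially:
  fixes h :: "'a::topological_space \<Rightarrow> ereal"
  assumes "closed_fun h" and "X \<longlonglongrightarrow> z" and "(\<lambda>k. h (X k)) \<longlonglongrightarrow> c"
  shows "h z \<le> c"
proof (rule dense_le)
  fix b assume b: "b < h z"
  have "h z \<le> Liminf (at z) h"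
    using assms(1) by (simp add: closed_fun_def)
  then have "eventually (\<lambda>y. b < h y) (at z)"
    using b by (simp add: le_Liminf_iff)
  then have "eventually (\<lambda>y. b < h y) (nhds z)"
    using b eventually_nhds_conv_at by blast
  then have "eventually (\<lambda>k. b < h (X k)) sequentially"
    using assms(2) by (rule eventually_compose_filterlim)
  then have "eventually (\<lambda>k. b \<le> h (X k)) sequentially"
    by (rule eventually_mono) simp
  then show "b \<le> c"
    by (rule tendsto_lowerbound[OF assms(3)]) simp
qed

lemma edist_le: "y \<in> C \<Longrightarrow> edist x C \<le> ereal (dist x y)"
  unfolding edist_def by (rule INF_lower)

lemma edist_nonneg: "0 \<le> edist x C"
  unfolding edist_def by (rule INF_greatest) simp

section \<open>Subgradients\<close>

text \<open>Sum rule for a smooth part \<open>s\<close> and a remainder with global subgradient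
  \<open>u\<close>: the difference quotient of \<open>h\<close> dominates the first-order error of
  \<open>s\<close>, which tends to 0.\<close>

lemma frechet_subdiffI:
  fixes h :: "'a::euclidean_space \<Rightarrow> ereal"
  assumes deriv: "GDERIV s p :> w"
    and fin: "\<bar>h p\<bar> \<noteq> \<infinity>"
    and minorant: "\<And>q. h p + ereal (s q - s p + inner u (q - p)) \<le> h q"
  shows "u + w \<in> frechet_subdiff h p"
proof -
  obtain c where c: "h p = ereal c" using fin by (cases "h p") auto
  let ?r = "\<lambda>q. (s q - s p - inner w (q - p)) / norm (q - p)"
  have "((\<lambda>q. norm (s q - s p - inner (q - p) w) / norm (q - p)) \<longlongrightarrow> 0) (at p)"
    using deriv unfolding gderiv_def has_derivative_iff_norm by simp
  then have "((\<lambda>q. norm (?r q)) \<longlongrightarrow> 0) (at p)"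
    by (simp add: norm_divide inner_commute)
  then have "(?r \<longlongrightarrow> 0) (at p)"
    by (rule tendsto_norm_zero_cancel)
  then have "((\<lambda>q. ereal (?r q)) \<longlongrightarrow> 0) (at p)"
    unfolding zero_ereal_def by (intro tendsto_intros)
  then have "Liminf (at p) (\<lambda>q. ereal (?r q)) = 0"
    by (intro lim_imp_Liminf) simp_all
  moreover have "Liminf (at p) (\<lambda>q. ereal (?r q))
      \<le> Liminf (at p) (\<lambda>q. (h q - h p - ereal (inner (u + w) (q - p))) / ereal (norm (q - p)))"
  proof (rule Liminf_mono, rule always_eventually, rule allI)
    fix q
    have m: "ereal (c + (s q - s p + inner u (q - p))) \<le> h q"
      using minorant[of q] by (simp add: c)
    show "ereal (?r q) \<le> (h q - h p - ereal (inner (u + w) (q - p))) / ereal (norm (q - p))"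
    proof (cases "q = p")
      \<comment> \<open>Both numerators vanish here, and 0/0 is 0 in \<open>real\<close> as in
        \<open>ereal\<close>.\<close>
      case True then show ?thesis by (simp add: c)
    next
      case False
      then have n: "norm (q - p) > 0" by simp
      show ?thesis
      proof (cases "h q")
        case (real d)
        have "s q - s p - inner w (q - p) \<le> d - c - inner (u + w) (q - p)"
          using m real by (simp add: inner_add_left)
        then have "?r q \<le> (d - c - inner (u + w) (q - p)) / norm (q - p)"
          using n by (intro divide_right_mono) auto
        then show ?thesis using n real c by simp
      next
        case PInf
        then show ?thesis using n c by simp
      next
        case MInf
        then show ?thesis using m by simp
      qed
    qed
  qed
  ultimately show ?thesis
    unfolding frechet_subdiff_def using fin by simp
qed

lemma frechet_subdiff_subset_subdiff: "frechet_subdiff h x \<subseteq> subdiff h x"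
proof
  fix v assume v: "v \<in> frechet_subdiff h x"
  then have "x \<in> dom_fun h"
    unfolding frechet_subdiff_def dom_fun_def by (cases "h x") auto
  then show "v \<in> subdiff h x"
    unfolding subdiff_def using v
    by (intro CollectI conjI exI[of _ "\<lambda>_. x"] exI[of _ "\<lambda>_. v"]) auto
qed

text \<open>The global subgradient of convex analysis, the working notion for \<open>P1\<close>; the
  additive form stays meaningful where \<open>h u\<close> is infinite.\<close>

definition convex_subgrad :: "('a::real_inner \<Rightarrow> ereal) \<Rightarrow> 'a \<Rightarrow> 'a \<Rightarrow> bool" where
  "convex_subgrad h x v \<longleftrightarrow> \<bar>h x\<bar> \<noteq> \<infinity> \<and> (\<forall>u. h x + ereal (inner v (u - x)) \<le> h u)"

lemma convex_subgrad_imp_subdiff: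
  fixes h :: "'a::euclidean_space \<Rightarrow> ereal"
  assumes "convex_subgrad h x v"
  shows "v \<in> subdiff h x"
proof -
  have "v + 0 \<in> frechet_subdiff h x"
    using assms unfolding convex_subgrad_def
    by (intro frechet_subdiffI[where s = "\<lambda>_. 0"]) (auto simp: GDERIV_const)
  then show ?thesis using frechet_subdiff_subset_subdiff by fastforce
qed

text \<open>If the inequality failed at \<open>u\<close>, convexity would keep the difference
  quotient along the segment from \<open>x\<close> towards \<open>u\<close> below a negative
  constant, against the Liminf condition.\<close>

lemma convex_frechet_subgrad:
  fixes g :: "'a::euclidean_space \<Rightarrow> real"
  assumes conv: "convex_on UNIV g" and v: "v \<in> frechet_subdiff (\<lambda>z. ereal (g z)) x"
  shows "g x + inner v (u - x) \<le> g u"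
proof (rule ccontr)
  assume "\<not> ?thesis"
  then have neg: "g u - g x - inner v (u - x) < 0" and ux: "u \<noteq> x" by auto
  define q where "q = (g u - g x - inner v (u - x)) / norm (u - x)"
  have q: "q < 0" using neg ux by (simp add: q_def divide_neg_pos)
  let ?Q = "\<lambda>y. (ereal (g y) - ereal (g x) - ereal (inner v (y - x))) / ereal (norm (y - x))"
  have "0 \<le> Liminf (at x) ?Q"
    using v by (simp add: frechet_subdiff_def)
  then have ev: "eventually (\<lambda>y. ereal q < ?Q y) (at x)"
    unfolding le_Liminf_iff using q by (simp add: zero_ereal_def)
  have lim: "filterlim (\<lambda>s. x + s *\<^sub>R (u - x)) (at x) (at_right 0)"
  proof (rule filterlim_atI)
    have "((\<lambda>s. x + s *\<^sub>R (u - x)) \<longlongrightarrow> x + 0 *\<^sub>R (u - x)) (at_right (0::real))"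
      by (intro tendsto_intros)
    then show "((\<lambda>s. x + s *\<^sub>R (u - x)) \<longlongrightarrow> x) (at_right (0::real))" by simp
    show "\<forall>\<^sub>F s in at_right (0::real). x + s *\<^sub>R (u - x) \<noteq> x"
      using ux by (auto simp: eventually_at_filter)
  qed
  have "eventually (\<lambda>s::real. s \<in> {0<..<1}) (at_right 0)"
    by (rule eventually_at_right_real) simp
  then have "eventually (\<lambda>s. s \<in> {0<..<1} \<and> ereal q < ?Q (x + s *\<^sub>R (u - x))) (at_right (0::real))"
    by (rule eventually_conj) (rule eventually_compose_filterlim[OF ev lim])
  then have "\<exists>s. s \<in> {0<..<1} \<and> ereal q < ?Q (x + s *\<^sub>R (u - x))"
    by (rule eventually_happens'[rotated]) simp
  then obtain s :: real where s: "0 < s" "s < 1" and Q: "ereal q < ?Q (x + s *\<^sub>R (u - x))"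
    unfolding greaterThanLessThan_iff by blast
  have "x + s *\<^sub>R (u - x) = (1 - s) *\<^sub>R x + s *\<^sub>R u" by (simp add: algebra_simps)
  then have "g (x + s *\<^sub>R (u - x)) \<le> (1 - s) * g x + s * g u"
    using convex_onD[OF conv, of s x u] s by simp
  then have "g (x + s *\<^sub>R (u - x)) - g x - s * inner v (u - x) \<le> s * (g u - g x - inner v (u - x))"
    by (simp add: algebra_simps)
  then have "(g (x + s *\<^sub>R (u - x)) - g x - s * inner v (u - x)) / (s * norm (u - x))
      \<le> (s * (g u - g x - inner v (u - x))) / (s * norm (u - x))"
    using s ux by (intro divide_right_mono) auto
  also have "\<dots> = q" using s by (simp add: q_def)
  finally show False using Q s ux by simp
qed

text \<open>The inequality holds at the approximating points and passes to the limit, since the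
  limiting subdifferential also demands convergence of the values.\<close>

lemma convex_subdiff_subgrad:
  fixes g :: "'a::euclidean_space \<Rightarrow> real"
  assumes "convex_on UNIV g" and "v \<in> subdiff (\<lambda>z. ereal (g z)) x"
  shows "g x + inner v (u - x) \<le> g u"
proof -
  obtain xs vs where lim: "xs \<longlonglongrightarrow> x" "(\<lambda>k. ereal (g (xs k))) \<longlonglongrightarrow> ereal (g x)" "vs \<longlonglongrightarrow> v"
    and vs: "\<And>k. vs k \<in> frechet_subdiff (\<lambda>z. ereal (g z)) (xs k)"
    using assms(2) unfolding subdiff_def by blast
  have "(\<lambda>k. g (xs k) + inner (vs k) (u - xs k)) \<longlonglongrightarrow> g x + inner v (u - x)"
    using lim by (intro tendsto_intros) auto
  then show ?thesis
    by (rule LIMSEQ_le_const2) (use convex_frechet_subgrad[OF assms(1) vs] in blast)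
qed

section \<open>Gradients, convexity and smoothness along lines\<close>

lemma GDERIV_along_line:
  fixes x d :: "'a::real_inner"
  assumes "GDERIV g (x + s *\<^sub>R d) :> v"
  shows "((\<lambda>s. g (x + s *\<^sub>R d)) has_real_derivative inner v d) (at s)"
proof -
  have "((\<lambda>s. x + s *\<^sub>R d) has_derivative (\<lambda>h. 0 + h *\<^sub>R d)) (at s)"
    by (intro has_derivative_add has_derivative_const has_derivative_scaleR_left has_derivative_ident)
  from has_derivative_compose[OF this assms[unfolded gderiv_def]]
  have "((\<lambda>s. g (x + s *\<^sub>R d)) has_derivative (\<lambda>h. inner (h *\<^sub>R d) v)) (at s)"
    by simp
  moreover have "(\<lambda>h. inner (h *\<^sub>R d) v) = (*) (inner v d)"
    by (simp add: fun_eq_iff inner_commute)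
  ultimately show ?thesis
    by (simp only: has_field_derivative_def)
qed

lemma GDERIV_convex_subgrad:
  fixes g :: "'a::real_inner \<Rightarrow> real"
  assumes "convex_on UNIV g" and "GDERIV g x :> v"
  shows "g x + inner v (u - x) \<le> g u"
proof -
  let ?G = "\<lambda>s. g (x + s *\<^sub>R (u - x))"
  have "convex_on UNIV ?G"
  proof (rule convex_onI)
    fix t a b :: real assume "0 < t" "t < 1"
    then have "g ((1 - t) *\<^sub>R (x + a *\<^sub>R (u - x)) + t *\<^sub>R (x + b *\<^sub>R (u - x)))
        \<le> (1 - t) * ?G a + t * ?G b"
      by (intro convex_onD[OF assms(1)]) auto
    then show "?G ((1 - t) *\<^sub>R a + t *\<^sub>R b) \<le> (1 - t) * ?G a + t * ?G b"
      by (simp add: algebra_simps)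
  qed auto
  moreover have "(?G has_real_derivative inner v (u - x)) (at 0)"
    using assms(2) by (intro GDERIV_along_line) simp
  ultimately have "?G 1 - ?G 0 \<ge> inner v (u - x) * (1 - 0)"
    by (intro convex_on_imp_above_tangent[of UNIV]) auto
  then show ?thesis by simp
qed

text \<open>With \<open>d = w - v\<close>, the function \<open>g (x + s d) - s (w, d)\<close> of
  \<open>s\<close> is minimal at 0, and its derivative there is minus the squared norm of
  \<open>d\<close>.\<close>

lemma subgrad_eq_GDERIV:
  fixes g :: "'a::real_inner \<Rightarrow> real"
  assumes "GDERIV g x :> v" and "\<And>u. g x + inner w (u - x) \<le> g u"
  shows "w = v"
proof -
  let ?d = "w - v"
  have "((\<lambda>s. g (x + s *\<^sub>R ?d) - s * inner w ?d) has_real_derivative inner v ?d - inner w ?d) (at 0)"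
    using assms(1) by (auto intro!: derivative_eq_intros GDERIV_along_line)
  moreover have "\<forall>s. \<bar>0 - s\<bar> < 1 \<longrightarrow> g (x + 0 *\<^sub>R ?d) - 0 * inner w ?d \<le> g (x + s *\<^sub>R ?d) - s * inner w ?d"
    using assms(2)[of "x + _ *\<^sub>R ?d"] by (auto simp: algebra_simps)
  ultimately have "inner v ?d - inner w ?d = 0"
    by (intro DERIV_local_min[where d = 1]) auto
  then have "inner ?d ?d = 0" by (simp add: inner_diff_left)
  then show ?thesis by simp
qed

lemma descent_lemma:
  fixes f :: "'a::euclidean_space \<Rightarrow> real"
  assumes diff: "\<And>z. f differentiable (at z)" and lip: "L-lipschitz_on UNIV (grad f)"
  shows "f u \<le> f y + inner (grad f y) (u - y) + L / 2 * (norm (u - y))\<^sup>2"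
proof -
  let ?d = "u - y"
  \<comment> \<open>Gap between \<open>f\<close> and its quadratic model on the segment; the
    Lipschitz bound makes its derivative nonpositive, so the gap decreases from \<open>s = 0\<close>
    to \<open>s = 1\<close>.\<close>
  let ?G = "\<lambda>s. f (y + s *\<^sub>R ?d) - s * inner (grad f y) ?d - L / 2 * s\<^sup>2 * (norm ?d)\<^sup>2"
  have "?G 1 \<le> ?G 0"
  proof (rule DERIV_nonpos_imp_nonincreasing[where f = ?G])
    fix s :: real assume s: "0 \<le> s" "s \<le> 1"
    let ?D = "inner (grad f (y + s *\<^sub>R ?d)) ?d - inner (grad f y) ?d - L * s * (norm ?d)\<^sup>2"
    have "(?G has_real_derivative ?D) (at s)"
      by (auto intro!: derivative_eq_intros GDERIV_along_line GDERIV_grad diff)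
    moreover have "?D \<le> 0"
    proof -
      have "inner (grad f (y + s *\<^sub>R ?d) - grad f y) ?d
          \<le> norm (grad f (y + s *\<^sub>R ?d) - grad f y) * norm ?d"
        by (rule norm_cauchy_schwarz)
      also have "\<dots> \<le> (L * norm (s *\<^sub>R ?d)) * norm ?d"
        using lipschitz_onD[OF lip, of "y + s *\<^sub>R ?d" y]
        by (intro mult_right_mono) (auto simp: dist_norm)
      also have "\<dots> = L * s * (norm ?d)\<^sup>2"
        using s by (simp add: power2_eq_square)
      finally show ?thesis by (simp add: inner_diff_left)
    qed
    ultimately show "\<exists>D. (?G has_real_derivative D) (at s) \<and> D \<le> 0" by blast
  qed simp
  then show ?thesis by simp
qed

text \<open>Testing the inequality one unit step along \<open>\<xi> t\<close> bounds
  \<open>norm (\<xi> t)\<close> by the oscillation of \<open>g\<close> on a ball enlarged by 1,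
  which is compact.\<close>

lemma bounded_subgrads:
  fixes g :: "'a::euclidean_space \<Rightarrow> real"
  assumes cont: "continuous_on UNIV g" and bdd: "bounded (range X)"
    and sub: "\<And>t u. g (X t) + inner (\<xi> t) (u - X t) \<le> g u"
  shows "bounded (range \<xi>)"
proof -
  obtain R where R: "\<And>t. norm (X t) \<le> R"
    using bdd by (auto simp: bounded_iff)
  have "compact (g ` cball 0 (R + 1))"
    using cont by (intro compact_continuous_image) (auto intro: continuous_on_subset)
  then have "bounded (g ` cball 0 (R + 1))"
    by (rule compact_imp_bounded)
  then obtain M where "\<forall>z\<in>g ` cball 0 (R + 1). norm z \<le> M"
    unfolding bounded_iff by blast
  then have M: "\<bar>g z\<bar> \<le> M" if "norm z \<le> R + 1" for z
    using that by auto
  have "norm (\<xi> t) \<le> 2 * M" for t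
  proof -
    let ?u = "X t + sgn (\<xi> t)"
    have "norm ?u \<le> R + 1"
      using R[of t] norm_triangle_ineq[of "X t" "sgn (\<xi> t)"] by (simp add: norm_sgn split: if_splits)
    then have "\<bar>g ?u\<bar> \<le> M" "\<bar>g (X t)\<bar> \<le> M"
      using M R[of t] by force+
    moreover have "inner (\<xi> t) (sgn (\<xi> t)) = norm (\<xi> t)"
      by (cases "\<xi> t = 0") (simp_all add: sgn_div_norm dot_square_norm power2_eq_square)
    ultimately show ?thesis using sub[of t ?u] by simp
  qed
  then show ?thesis by (auto simp: bounded_iff)
qed

text \<open>First-order optimality: minus the gradient of the quadratic part at the minimizer is a
  subgradient of \<open>h\<close>.\<close>

lemma prox_subgrad:
  fixes h :: "'a::real_inner \<Rightarrow> ereal"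
  assumes proper: "proper_fun h" and conv: "convex_fun h"
    and min: "is_arg_min (\<lambda>z. ereal (inner g z + L / 2 * (norm (z - y))\<^sup>2) + h z) (\<lambda>z. True) p"
  shows "convex_subgrad h p (L *\<^sub>R (y - p) - g)"
proof -
  let ?q = "\<lambda>z. inner g z + L / 2 * (norm (z - y))\<^sup>2"
  have le: "ereal (?q p) + h p \<le> ereal (?q z) + h z" for z
    using min unfolding is_arg_min_def by (meson linorder_not_less)
  have nm: "h z \<noteq> -\<infinity>" for z using proper by (simp add: proper_fun_def)
  obtain z0 where "h z0 < \<infinity>" using proper by (auto simp: proper_fun_def dom_fun_def)
  then have "h p \<noteq> \<infinity>" using le[of z0] by (cases "h z0") auto
  then obtain c where c: "h p = ereal c" using nm[of p] by (cases "h p") auto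
  have "h p + ereal (inner (L *\<^sub>R (y - p) - g) (z - p)) \<le> h z" for z
  proof (cases "h z")
    case (real b)
    \<comment> \<open>Comparing \<open>p\<close> with \<open>p + s (z - p)\<close> and dividing by \<open>s\<close> leaves \<open>?A\<close> up to an error of order \<open>s\<close>.\<close>
    let ?A = "b - c - inner (L *\<^sub>R (y - p) - g) (z - p)"
    let ?B = "L / 2 * (norm (z - p))\<^sup>2"
    have norm_sq: "(norm (v + s *\<^sub>R d))\<^sup>2 = (norm v)\<^sup>2 + 2 * s * inner v d + s\<^sup>2 * (norm d)\<^sup>2"
      for v d :: 'a and s
      by (simp only: power2_norm_eq_inner)
        (simp add: inner_simps inner_commute power2_eq_square algebra_simps)
    have AB: "0 \<le> ?A + s * ?B" if s: "0 < s" "s < 1" for s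
    proof -
      let ?w = "(1 - s) *\<^sub>R p + s *\<^sub>R z"
      have "h ?w \<le> ereal (1 - s) * h p + ereal s * h z"
        using conv s unfolding convex_fun_def by auto
      then have hw: "h ?w \<le> ereal ((1 - s) * c + s * b)" by (simp add: c real)
      have "ereal (?q p + c) \<le> ereal (?q ?w) + h ?w" using le[of ?w] by (simp add: c)
      also have "\<dots> \<le> ereal (?q ?w) + ereal ((1 - s) * c + s * b)"
        using hw by (rule add_left_mono)
      finally have 1: "?q p + c \<le> ?q ?w + (1 - s) * c + s * b" by simp
      have w: "?w - y = (p - y) + s *\<^sub>R (z - p)" "?w = p + s *\<^sub>R (z - p)"
        by (simp_all add: algebra_simps)
      have w_norm: "(norm (?w - y))\<^sup>2 = (norm (p - y))\<^sup>2 + 2 * s * inner (p - y) (z - p) + s\<^sup>2 * (norm (z - p))\<^sup>2"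
        unfolding w(1) by (rule norm_sq)
      have w_inner: "inner g ?w = inner g p + s * inner g (z - p)"
        unfolding w(2) by (simp add: inner_simps)
      have "?q ?w = ?q p + s * (inner g (z - p) + L * inner (p - y) (z - p)) + s\<^sup>2 * ?B"
        unfolding w_norm w_inner by (simp add: algebra_simps)
      moreover have "inner (L *\<^sub>R (y - p) - g) (z - p) = - (inner g (z - p) + L * inner (p - y) (z - p))"
        by (simp add: inner_diff_left algebra_simps)
      ultimately have "0 \<le> s * (?A + s * ?B)"
        using 1 by (simp add: algebra_simps power2_eq_square)
      then show ?thesis using s by (simp add: zero_le_mult_iff)
    qed
    have "((\<lambda>s. ?A + s * ?B) \<longlongrightarrow> ?A + 0 * ?B) (at_right 0)"
      by (intro tendsto_intros)
    moreover have "eventually (\<lambda>s::real. s \<in> {0<..<1}) (at_right 0)"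
      by (rule eventually_at_right_real) simp
    then have "eventually (\<lambda>s. 0 \<le> ?A + s * ?B) (at_right 0)"
      by (rule eventually_mono) (use AB in auto)
    ultimately have "0 \<le> ?A + 0 * ?B"
      by (rule tendsto_lowerbound) simp
    then show ?thesis by (simp add: c real)
  qed (use nm in auto)
  then show ?thesis by (simp add: convex_subgrad_def c)
qed

section \<open>Finite length from the Kurdyka--Lojasiewicz inequality\<close>

text \<open>The step inequality is only available inside the ball, so the induction proves at the
  same time that the sequence never leaves it. Its invariant is that
  \<open>(\<Sum>t<k. D t) + 2 * D k + 2 * b k\<close> does not increase with \<open>k\<close>; since \<open>D (Suc k)\<close> is not yet
  controlled when \<open>x (Suc (Suc k))\<close> is to be placed in the ball, \<open>small\<close> is needed.\<close>

lemma finite_length_near: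
  fixes x :: "nat \<Rightarrow> 'a::metric_space" and b :: "nat \<Rightarrow> real"
  defines "D \<equiv> \<lambda>t. dist (x (Suc t)) (x t)"
  assumes step: "\<And>t. \<lbrakk>x t \<in> ball z \<rho>; x (Suc t) \<in> ball z \<rho>; x (Suc (Suc t)) \<in> ball z \<rho>\<rbrakk>
      \<Longrightarrow> D (Suc t) \<le> D t / 2 + (b t - b (Suc t))"
    and b: "\<And>t. 0 \<le> b t"
    and small: "\<And>t. D t < \<rho> / 4"
    and start: "dist z (x 0) + 2 * D 0 + 2 * b 0 < \<rho> / 2"
  shows "summable D"
proof -
  have D0: "0 \<le> D t" for t by (simp add: D_def)
  have path: "dist z (x n) \<le> dist z (x 0) + (\<Sum>t<n. D t)" for n
  proof (induction n)
    case (Suc n)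
    have "dist z (x (Suc n)) \<le> dist z (x n) + D n"
      unfolding D_def by metric
    then show ?case using Suc by simp
  qed simp
  have claim: "x k \<in> ball z \<rho> \<and> x (Suc k) \<in> ball z \<rho> \<and>
      (\<Sum>t<k. D t) + 2 * D k + 2 * b k \<le> 2 * D 0 + 2 * b 0" for k
  proof (induction k)
    case 0
    show ?case using start b[of 0] D0[of 0] path[of 1] zero_le_dist[of z "x 0"]
      by (simp del: zero_le_dist)
  next
    case (Suc k)
    have "dist z (x (Suc (Suc k))) \<le> dist z (x 0) + (\<Sum>t<k. D t) + D k + D (Suc k)"
      using path[of "Suc (Suc k)"] by simp
    \<comment> \<open>The invariant and \<open>start\<close> keep the first three terms below
      \<open>\<rho> / 2\<close>; \<open>small\<close> bounds the last by
      \<open>\<rho> / 4\<close>.\<close>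
    also have "\<dots> < \<rho>"
      using Suc small[of "Suc k"] start b[of k] D0[of k] D0[of "Suc k"] by linarith
    finally have "x (Suc (Suc k)) \<in> ball z \<rho>" by simp
    with Suc step[of k] show ?case by simp
  qed
  have "(\<Sum>t<k. D t) \<le> 2 * D 0 + 2 * b 0" for k
    using claim[of k] D0[of k] b[of k] by linarith
  then show ?thesis using D0 by (intro summableI_nonneg_bounded)
qed

text \<open>The negation would force a sum of squares to be negative. The factor 1/2 on
  \<open>d\<close> makes the steps summable once \<open>\<Delta>\<close> telescopes.\<close>

lemma KL_step_ineq:
  fixes d d' K \<Delta> :: real
  assumes "0 \<le> d" "0 \<le> d'" "0 \<le> K * \<Delta>" and "d'\<^sup>2 \<le> K * \<Delta> * (d' + d)"
  shows "d' \<le> d / 2 + 2 * K * \<Delta>"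
proof (rule ccontr)
  assume "\<not> ?thesis"
  then have lt: "K * \<Delta> < (d' - d / 2) / 2" by simp
  then have "0 < d'" using assms by auto
  then have "K * \<Delta> * (d' + d) < (d' - d / 2) / 2 * (d' + d)"
    using lt assms by (intro mult_strict_right_mono) auto
  then have "4 * d'\<^sup>2 < (2 * d' - d) * (d' + d)"
    using assms(4) by (simp add: field_simps)
  then have "2 * d'\<^sup>2 - d' * d + d\<^sup>2 < 0"
    by (simp add: field_simps power2_eq_square)
  moreover have "2 * d'\<^sup>2 - d' * d + d\<^sup>2 = (d' - d / 2)\<^sup>2 + d'\<^sup>2 + 3 / 4 * d\<^sup>2"
    by (simp add: field_simps power2_eq_square)
  ultimately show False
    using zero_le_power2[of "d' - d / 2"] zero_le_power2[of d'] zero_le_power2[of d] by linarith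
qed

lemma convergent_of_summable_increments:
  fixes x :: "nat \<Rightarrow> 'a::banach"
  assumes "summable (\<lambda>t. norm (x (Suc t) - x t))"
  shows "convergent x"
proof -
  have "summable (\<lambda>t. x (Suc t) - x t)"
    using assms by (rule summable_norm_cancel)
  then have "(\<lambda>n. \<Sum>t<n. x (Suc t) - x t) \<longlonglongrightarrow> (\<Sum>t. x (Suc t) - x t)"
    by (rule summable_LIMSEQ)
  then have "(\<lambda>n. (x n - x 0) + x 0) \<longlonglongrightarrow> (\<Sum>t. x (Suc t) - x t) + x 0"
    by (intro tendsto_intros) (simp add: sum_lessThan_telescope)
  then show ?thesis by (auto simp: convergent_def)
qed

lemma increments_tendsto_0:
  fixes D e :: "nat \<Rightarrow> real"
  assumes H: "0 < H" and desc: "\<And>t. H * (D t)\<^sup>2 \<le> e t - e (Suc t)"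
    and lim: "e \<longlonglongrightarrow> l" and nonneg: "\<And>t. 0 \<le> D t"
  shows "D \<longlonglongrightarrow> 0"
proof (rule tendsto_sandwich[OF _ _ tendsto_const])
  show "\<forall>\<^sub>F t in sequentially. D t \<le> sqrt ((e t - e (Suc t)) / H)"
  proof (intro always_eventually allI real_le_rsqrt)
    fix t
    show "(D t)\<^sup>2 \<le> (e t - e (Suc t)) / H"
      using desc[of t] H by (simp add: field_simps)
  qed
  have "(\<lambda>t. sqrt ((e t - e (Suc t)) / H)) \<longlonglongrightarrow> sqrt ((l - l) / H)"
    using lim LIMSEQ_Suc[OF lim] H by (intro tendsto_intros) auto
  then show "(\<lambda>t. sqrt ((e t - e (Suc t)) / H)) \<longlonglongrightarrow> 0" by simp
qed (simp add: nonneg)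

text \<open>Here \<open>e\<close> is the excess of the values over \<open>\<zeta>\<close>. Concavity
  gives \<open>\<phi> (e t) - \<phi> (e (Suc t))\<close> at least \<open>\<phi>' (e t)\<close> times
  the decrease of \<open>e\<close>, hence times \<open>H * (D t)\<^sup>2\<close>. The
  Kurdyka--Lojasiewicz inequality bounds \<open>\<phi>' (e t)\<close> below by the reciprocal of two
  consecutive steps. Together they give the quadratic inequality of
  \<open>KL_step_ineq\<close>.\<close>

lemma KL_finite_length:
  fixes h :: "'a::euclidean_space \<times> 'a \<Rightarrow> ereal" and x :: "nat \<Rightarrow> 'a"
  defines "D \<equiv> \<lambda>t. norm (x (Suc t) - x t)"
  assumes KL: "KL_property_at h (z, z)" and hz: "h (z, z) = ereal \<zeta>"
    and he: "\<And>t. h (x (Suc t), x t) = ereal (\<zeta> + e t)"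
    and H: "0 < H" and desc: "\<And>t. H * (D t)\<^sup>2 \<le> e t - e (Suc t)"
    and e0: "e \<longlonglongrightarrow> 0"
    and \<rho>: "0 < \<rho>"
    and sub: "\<And>t. \<lbrakk>x t \<in> ball z \<rho>; x (Suc t) \<in> ball z \<rho>; x (Suc (Suc t)) \<in> ball z \<rho>\<rbrakk>
      \<Longrightarrow> \<exists>v\<in>subdiff h (x (Suc (Suc t)), x (Suc t)). norm v \<le> C * (D (Suc t) + D t)"
    and r: "strict_mono r" "(x \<circ> r) \<longlonglongrightarrow> z"
  shows "summable D" and "x \<longlonglongrightarrow> z"
proof -
  have D0: "0 \<le> D t" for t by (simp add: D_def)
  have "e (Suc t) \<le> e t" for t
  proof -
    have "0 \<le> H * (D t)\<^sup>2" using H by simp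
    then show ?thesis using desc[of t] by linarith
  qed
  then have dec: "decseq e" by (rule decseq_SucI)
  have e_nn: "0 \<le> e t" for t
    using decseq_ge[OF dec e0] .
  have D_lim: "D \<longlonglongrightarrow> 0"
    using increments_tendsto_0[OF H desc e0 D0] .
  show sum: "summable D"
  \<comment> \<open>The Kurdyka--Lojasiewicz inequality needs values strictly above
    \<open>h (z, z)\<close>. If the excess reaches 0, descent makes the sequence constant from then
    on.\<close>
  proof (cases "\<exists>t0. e t0 = 0")
    case True
    then obtain t0 where t0: "e t0 = 0" by blast
    have "D t = 0" if "t \<ge> t0" for t
    proof -
      have "e t = 0" using decseqD[OF dec that] t0 e_nn[of t] by simp
      then have "H * (D t)\<^sup>2 \<le> 0" using desc[of t] e_nn[of "Suc t"] by simp
      then show ?thesis using H by (simp add: mult_le_0_iff)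
    qed
    then show ?thesis by (intro summable_finite[of "{..<t0}"]) auto
  next
    case False
    then have e_pos: "0 < e t" for t using e_nn[of t] by (simp add: order_less_le)
    obtain a U \<phi> \<phi>' where a: "0 < a" and U: "open U" "(z, z) \<in> U"
      and cont: "continuous_on {s. 0 \<le> s \<and> ereal s < a} \<phi>"
      and conc: "concave_on {s. 0 \<le> s \<and> ereal s < a} \<phi>"
      and nn: "\<forall>s. 0 \<le> s \<and> ereal s < a \<longrightarrow> 0 \<le> \<phi> s"
      and \<phi>0: "\<phi> 0 = 0"
      and der: "\<forall>s. 0 < s \<and> ereal s < a \<longrightarrow> (\<phi> has_real_derivative \<phi>' s) (at s)"
      and pos: "\<forall>s. 0 < s \<and> ereal s < a \<longrightarrow> 0 < \<phi>' s"
      and ineq: "\<forall>w\<in>U. h (z, z) < h w \<and> h w < h (z, z) + a \<longrightarrow>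
           1 \<le> ereal (\<phi>' (real_of_ereal (h w - h (z, z)))) * edist 0 (subdiff h w)"
      using KL unfolding KL_property_at_def by blast
    let ?I = "{s. 0 \<le> s \<and> ereal s < a}"
    \<comment> \<open>\<open>C\<close> has no sign assumption; a positive constant makes
      \<open>K\<close> positive.\<close>
    define C' where "C' = max C 1"
    have C': "0 < C'" "C \<le> C'" by (auto simp: C'_def)
    define K where "K = C' / H"
    have K: "0 < K" using C' H by (simp add: K_def)
    \<comment> \<open>A box inside \<open>U\<close> lets one ball around \<open>z\<close> control
      both components of a pair.\<close>
    obtain A B where AB: "open A" "open B" "z \<in> A" "z \<in> B" "A \<times> B \<subseteq> U"
      using U by (metis open_prod_elim mem_Sigma_iff)
    then have "open (A \<inter> B \<inter> ball z \<rho>)" "z \<in> A \<inter> B \<inter> ball z \<rho>" using \<rho> by auto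
    then obtain \<sigma> where \<sigma>: "0 < \<sigma>" "ball z \<sigma> \<subseteq> A \<inter> B \<inter> ball z \<rho>"
      using open_contains_ball by blast
    have a_ev: "\<forall>\<^sub>F t in sequentially. ereal (e t) < a"
    proof -
      have "(\<lambda>t. ereal (e t)) \<longlonglongrightarrow> ereal 0" using e0 by (intro tendsto_intros)
      then show ?thesis using a by (intro order_tendstoD(2)[of _ "ereal 0"]) (auto simp: zero_ereal_def)
    qed
    have \<phi>_lim: "(\<lambda>t. \<phi> (e t)) \<longlonglongrightarrow> 0"
    proof -
      have "(\<lambda>t. \<phi> (e t)) \<longlonglongrightarrow> \<phi> 0"
        using cont e0
      proof (rule continuous_on_tendsto_compose)
        show "0 \<in> ?I" using a by (simp add: zero_ereal_def)
        show "\<forall>\<^sub>F t in sequentially. e t \<in> ?I"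
          using a_ev by (rule eventually_mono) (simp add: e_nn)
      qed
      then show ?thesis by (simp add: \<phi>0)
    qed
    \<comment> \<open>The starting quantity of \<open>finite_length_near\<close> tends to 0 along
      the subsequence, so some large \<open>T = r k\<close> can serve as the new origin.\<close>
    have "(\<lambda>k. dist z (x (r k)) + 2 * D (r k) + 2 * (2 * K * \<phi> (e (Suc (r k)))))
        \<longlonglongrightarrow> dist z z + 2 * 0 + 2 * (2 * K * 0)"
      using r(2) LIMSEQ_subseq_LIMSEQ[OF D_lim r(1)]
        LIMSEQ_subseq_LIMSEQ[OF LIMSEQ_Suc[OF \<phi>_lim] r(1)]
      by (intro tendsto_intros) (simp_all add: o_def)
    then have "\<forall>\<^sub>F k in sequentially.
        dist z (x (r k)) + 2 * D (r k) + 2 * (2 * K * \<phi> (e (Suc (r k)))) < \<sigma> / 2"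
      using \<sigma> by (intro order_tendstoD(2)) auto
    moreover have "\<forall>\<^sub>F t in sequentially. ereal (e t) < a \<and> D t < \<sigma> / 4"
      using a_ev \<sigma>(1) by (intro eventually_conj order_tendstoD(2)[OF D_lim]) auto
    then obtain T1 where T1: "\<And>t. t \<ge> T1 \<Longrightarrow> ereal (e t) < a \<and> D t < \<sigma> / 4"
      unfolding eventually_sequentially by blast
    have "\<forall>\<^sub>F k in sequentially. T1 \<le> r k"
      using filterlim_subseq[OF r(1)] by (simp add: filterlim_at_top)
    ultimately have "\<forall>\<^sub>F k in sequentially. T1 \<le> r k \<and>
        dist z (x (r k)) + 2 * D (r k) + 2 * (2 * K * \<phi> (e (Suc (r k)))) < \<sigma> / 2"
      by (rule eventually_conj[rotated])
    then obtain k where "T1 \<le> r k \<and>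
        dist z (x (r k)) + 2 * D (r k) + 2 * (2 * K * \<phi> (e (Suc (r k)))) < \<sigma> / 2"
      by (auto simp: eventually_sequentially)
    then obtain T where T: "T1 \<le> T" "dist z (x T) + 2 * D T + 2 * (2 * K * \<phi> (e (Suc T))) < \<sigma> / 2"
      by blast
    have a_le: "ereal (e t) < a" if "T \<le> t" for t using T1[of t] T(1) that by simp
    have "summable (\<lambda>t. dist (x (Suc t + T)) (x (t + T)))"
    proof (rule finite_length_near[where z = z and \<rho> = \<sigma> and b = "\<lambda>t. 2 * K * \<phi> (e (Suc (t + T)))"])
      fix t0
      let ?t = "t0 + T"
      assume "x (t0 + T) \<in> ball z \<sigma>" "x (Suc t0 + T) \<in> ball z \<sigma>" "x (Suc (Suc t0) + T) \<in> ball z \<sigma>"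
      then have near: "x ?t \<in> ball z \<sigma>" "x (Suc ?t) \<in> ball z \<sigma>" "x (Suc (Suc ?t)) \<in> ball z \<sigma>"
        by simp_all
      obtain v where v: "v \<in> subdiff h (x (Suc (Suc ?t)), x (Suc ?t))"
        and vn: "norm v \<le> C * (D (Suc ?t) + D ?t)"
        using sub[of ?t] near \<sigma>(2) by blast
      let ?e = "e (Suc ?t)" and ?e' = "e (Suc (Suc ?t))"
      have ea: "ereal ?e < a" "ereal ?e' < a" using a_le by simp_all
      have "1 \<le> ereal (\<phi>' ?e) * edist 0 (subdiff h (x (Suc (Suc ?t)), x (Suc ?t)))"
      proof -
        have "(x (Suc (Suc ?t)), x (Suc ?t)) \<in> U" using near AB(5) \<sigma>(2) by blast
        moreover have "h (z, z) < h (x (Suc (Suc ?t)), x (Suc ?t))"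
          using he[of "Suc ?t"] hz e_pos[of "Suc ?t"] by simp
        moreover have "h (x (Suc (Suc ?t)), x (Suc ?t)) < h (z, z) + a"
          using he[of "Suc ?t"] hz ea(1) a by (cases a) auto
        moreover have "real_of_ereal (h (x (Suc (Suc ?t)), x (Suc ?t)) - h (z, z)) = ?e"
          using he[of "Suc ?t"] hz by simp
        ultimately show ?thesis using ineq by metis
      qed
      also have "\<dots> \<le> ereal (\<phi>' ?e) * ereal (norm v)"
        using edist_le[OF v, of 0] pos ea(1) e_pos[of "Suc ?t"]
        by (intro ereal_mult_left_mono) (auto simp: less_imp_le)
      finally have "1 \<le> \<phi>' ?e * norm v" by (simp add: one_ereal_def)
      also have "\<dots> \<le> \<phi>' ?e * (C' * (D (Suc ?t) + D ?t))"
        using vn C' D0[of "Suc ?t"] D0[of ?t] pos ea(1) e_pos[of "Suc ?t"]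
        by (intro mult_left_mono order_trans[OF vn] mult_right_mono) (auto simp: less_imp_le)
      finally have one: "1 \<le> \<phi>' ?e * (C' * (D (Suc ?t) + D ?t))" .
      let ?\<Delta> = "\<phi> ?e - \<phi> ?e'"
      \<comment> \<open>Tangent inequality at \<open>?e\<close> for the convex function
        \<open>- \<phi>\<close>.\<close>
      have "(\<lambda>s. - \<phi> s) ?e' - (\<lambda>s. - \<phi> s) ?e \<ge> - \<phi>' ?e * (?e' - ?e)"
      proof (rule convex_on_imp_above_tangent)
        show "convex_on ?I (\<lambda>s. - \<phi> s)" using conc by (simp add: concave_on_def)
        show "connected ?I"
          using conc by (intro convex_connected) (simp add: concave_on_def convex_on_def)
        show "?e \<in> interior ?I"
        proof (rule interiorI[of "{s. 0 < s \<and> ereal s < a}"])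
          show "open {s. 0 < s \<and> ereal s < a}"
            by (intro open_Collect_conj open_Collect_less continuous_on_ereal continuous_intros)
        qed (use ea e_pos in auto)
        show "?e' \<in> ?I" using ea e_nn by simp
        show "((\<lambda>s. - \<phi> s) has_real_derivative - \<phi>' ?e) (at ?e within ?I)"
          using der ea(1) e_pos[of "Suc ?t"]
          by (intro DERIV_minus) (auto intro: has_field_derivative_at_within)
      qed
      then have "\<phi>' ?e * (?e - ?e') \<le> ?\<Delta>" by (simp add: algebra_simps)
      moreover have "\<phi>' ?e * (H * (D (Suc ?t))\<^sup>2) \<le> \<phi>' ?e * (?e - ?e')"
        using desc[of "Suc ?t"] pos ea(1) e_pos[of "Suc ?t"] by (intro mult_left_mono) (auto simp: less_imp_le)
      ultimately have \<Delta>: "\<phi>' ?e * (H * (D (Suc ?t))\<^sup>2) \<le> ?\<Delta>" by linarith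
      have "0 \<le> \<phi>' ?e * (H * (D (Suc ?t))\<^sup>2)"
        using H pos ea(1) e_pos[of "Suc ?t"] by (auto simp: less_imp_le)
      then have \<Delta>0: "0 \<le> ?\<Delta>" using \<Delta> by linarith
      \<comment> \<open>Multiplying by \<open>one\<close> and then applying \<open>\<Delta>\<close>
        eliminates the factor \<open>\<phi>' ?e\<close>.\<close>
      have "(H * (D (Suc ?t))\<^sup>2) * 1 \<le> (H * (D (Suc ?t))\<^sup>2) * (\<phi>' ?e * (C' * (D (Suc ?t) + D ?t)))"
        using H one by (intro mult_left_mono) auto
      also have "\<dots> = (\<phi>' ?e * (H * (D (Suc ?t))\<^sup>2)) * (C' * (D (Suc ?t) + D ?t))"
        by (simp only: mult_ac)
      also have "\<dots> \<le> ?\<Delta> * (C' * (D (Suc ?t) + D ?t))"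
        using \<Delta> C' D0 by (intro mult_right_mono) auto
      finally have "(D (Suc ?t))\<^sup>2 \<le> K * ?\<Delta> * (D (Suc ?t) + D ?t)"
        using H by (simp add: K_def field_simps)
      then have "D (Suc ?t) \<le> D ?t / 2 + 2 * K * ?\<Delta>"
        using K \<Delta>0 D0 by (intro KL_step_ineq) auto
      then show "dist (x (Suc (Suc t0) + T)) (x (Suc t0 + T)) \<le> dist (x (Suc t0 + T)) (x (t0 + T)) / 2 +
          (2 * K * \<phi> (e (Suc (t0 + T))) - 2 * K * \<phi> (e (Suc (Suc t0 + T))))"
        by (simp add: D_def dist_norm algebra_simps)
    next
      fix t show "0 \<le> 2 * K * \<phi> (e (Suc (t + T)))"
        using K nn e_nn a_le[of "Suc (t + T)"] by simp
    next
      fix t show "dist (x (Suc t + T)) (x (t + T)) < \<sigma> / 4"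
        using T1[of "t + T"] T(1) by (simp add: D_def dist_norm)
    next
      show "dist z (x (0 + T)) + 2 * dist (x (Suc 0 + T)) (x (0 + T)) +
          2 * (2 * K * \<phi> (e (Suc (0 + T)))) < \<sigma> / 2"
        using T(2) by (simp add: D_def dist_norm)
    qed
    then have "summable (\<lambda>t. D (t + T))" by (simp add: D_def dist_norm)
    then show ?thesis by (simp only: summable_iff_shift)
  qed
  obtain l where l: "x \<longlonglongrightarrow> l"
    using convergent_of_summable_increments[of x] sum by (auto simp: D_def convergent_def)
  then have "(x \<circ> r) \<longlonglongrightarrow> l" using r(1) by (rule LIMSEQ_subseq_LIMSEQ)
  then have "l = z" using r(2) by (rule LIMSEQ_unique)
  then show "x \<longlonglongrightarrow> z" using l by simp
qed

section \<open>The iterates of the algorithm\<close>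

text \<open>The setting of the descent and cluster point arguments; smoothness of \<open>P2\<close>
  and the Kurdyka--Lojasiewicz assumption enter only in later lemmas.\<close>

locale pDCAe =
  fixes f P2 :: "'a::euclidean_space \<Rightarrow> real"
    and P1 :: "'a \<Rightarrow> ereal"
    and L :: real
    and \<beta> :: "nat \<Rightarrow> real"
    and x :: "nat \<Rightarrow> 'a"
  assumes L: "0 < L"
    and f_convex: "convex_on UNIV f"
    and f_diff: "\<And>z. f differentiable (at z)"
    and f_lip: "L-lipschitz_on UNIV (grad f)"
    and P1_proper: "proper_fun P1" and P1_closed: "closed_fun P1" and P1_convex: "convex_fun P1"
    and P2_cont: "continuous_on UNIV P2" and P2_convex: "convex_on UNIV P2"
    and F_level: "level_bounded (objective_F f P1 P2)"
    and x_pDCAe: "pDCAe_sequence f P1 P2 L \<beta> x"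
begin

abbreviation "E \<equiv> objective_E f P1 P2 L"

definition "y t = x t + \<beta> t *\<^sub>R (x t - x (t - 1))"

text \<open>The algorithm only asserts a subgradient for each step separately; this fixes one
  sequence of witnesses.\<close>

definition "\<xi> = (SOME \<xi>. \<forall>t. \<xi> t \<in> subdiff (\<lambda>z. ereal (P2 z)) (x t) \<and>
  is_arg_min (\<lambda>z. ereal (inner (grad f (y t) - \<xi> t) z + L / 2 * (norm (z - y t))\<^sup>2) + P1 z)
    (\<lambda>z. True) (x (Suc t)))"

text \<open>The subgradient of \<open>P1\<close> at \<open>x (Suc t)\<close> delivered by optimality
  of the prox step.\<close>

definition "v t = L *\<^sub>R (y t - x (Suc t)) - (grad f (y t) - \<xi> t)"

definition "p t = real_of_ereal (P1 (x t))"

definition "F_val t = f (x t) + p t - P2 (x t)"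

definition "E_val t = F_val t + L / 2 * (norm (x t - x (t - 1)))\<^sup>2"

definition "D t = norm (x (Suc t) - x t)"

lemma \<xi>_prop:
  "\<xi> t \<in> subdiff (\<lambda>z. ereal (P2 z)) (x t) \<and>
   is_arg_min (\<lambda>z. ereal (inner (grad f (y t) - \<xi> t) z + L / 2 * (norm (z - y t))\<^sup>2) + P1 z)
     (\<lambda>z. True) (x (Suc t))"
proof -
  have "\<forall>t. \<exists>w. w \<in> subdiff (\<lambda>z. ereal (P2 z)) (x t) \<and>
      is_arg_min (\<lambda>z. ereal (inner (grad f (y t) - w) z + L / 2 * (norm (z - y t))\<^sup>2) + P1 z)
        (\<lambda>z. True) (x (Suc t))"
    using x_pDCAe unfolding pDCAe_sequence_def y_def Let_def by blast
  from someI_ex[OF choice[OF this]] show ?thesis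
    unfolding \<xi>_def by blast
qed

lemma \<xi>_subgrad: "P2 (x t) + inner (\<xi> t) (u - x t) \<le> P2 u"
  using \<xi>_prop convex_subdiff_subgrad[OF P2_convex] by blast

lemma v_subgrad: "convex_subgrad P1 (x (Suc t)) (v t)"
  unfolding v_def using \<xi>_prop by (intro prox_subgrad[OF P1_proper P1_convex]) blast

lemma P1_x: "P1 (x t) = ereal (p t)"
proof (cases t)
  case 0
  have "P1 (x 0) < \<infinity>" "P1 (x 0) \<noteq> -\<infinity>"
    using x_pDCAe P1_proper by (auto simp: pDCAe_sequence_def dom_fun_def proper_fun_def)
  then show ?thesis using 0 unfolding p_def by (cases "P1 (x 0)") auto
next
  case (Suc s)
  then show ?thesis using v_subgrad[of s] unfolding p_def convex_subgrad_def
    by (simp add: ereal_real)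
qed

lemma F_x: "objective_F f P1 P2 (x t) = ereal (F_val t)"
  by (simp add: objective_F_def P1_x F_val_def)

lemma E_x: "E (x t, x (t - 1)) = ereal (E_val t)"
  by (simp add: objective_E_def P1_x F_val_def E_val_def)

section \<open>Descent and boundedness\<close>

definition "H = L / 2 * (1 - (SUP t. \<beta> t)\<^sup>2)"

lemma \<beta>_bounds: "0 \<le> \<beta> t" "\<beta> t \<le> (SUP t. \<beta> t)" "(SUP t. \<beta> t) < 1"
proof -
  have *: "0 \<le> \<beta> t \<and> \<beta> t < 1" for t using x_pDCAe by (auto simp: pDCAe_sequence_def)
  show "0 \<le> \<beta> t" using * by blast
  have "bdd_above (range \<beta>)" using * by (intro bdd_aboveI[of _ 1]) (auto simp: less_imp_le)
  then show "\<beta> t \<le> (SUP t. \<beta> t)" by (intro cSUP_upper) auto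
  show "(SUP t. \<beta> t) < 1" using x_pDCAe by (simp add: pDCAe_sequence_def)
qed

lemma H_pos: "0 < H"
proof -
  have "0 \<le> (SUP t. \<beta> t)" using \<beta>_bounds(1,2) order_trans by blast
  then have "(SUP t. \<beta> t)\<^sup>2 < 1" using \<beta>_bounds(3) by (simp add: power_less_one_iff)
  then show ?thesis using L by (simp add: H_def)
qed

lemma norm_y: "norm (y t - x t) \<le> norm (x t - x (t - 1))"
proof -
  have "\<beta> t \<le> 1" using \<beta>_bounds(2)[of t] \<beta>_bounds(3) by simp
  then show ?thesis using \<beta>_bounds(1)[of t]
    by (simp add: y_def mult_left_le_one_le)
qed

text \<open>Adds the descent lemma from \<open>y t\<close> to \<open>x (Suc t)\<close>, convexity of
  \<open>f\<close>, and the subgradient inequalities for \<open>P2\<close> and \<open>P1\<close>.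
  The linear terms cancel by 5, and the polarization identity 6 removes the squared distance from
  \<open>x (Suc t)\<close> to \<open>y t\<close>.\<close>

lemma F_descent: "F_val (Suc t) \<le> F_val t + L / 2 * (norm (x t - y t))\<^sup>2 - L / 2 * (D t)\<^sup>2"
proof -
  have 1: "f (x (Suc t)) \<le> f (y t) + inner (grad f (y t)) (x (Suc t) - y t) + L / 2 * (norm (x (Suc t) - y t))\<^sup>2"
    by (rule descent_lemma[OF f_diff f_lip])
  have 2: "f (y t) + inner (grad f (y t)) (x t - y t) \<le> f (x t)"
    by (rule GDERIV_convex_subgrad[OF f_convex GDERIV_grad[OF f_diff]])
  have 3: "P2 (x t) + inner (\<xi> t) (x (Suc t) - x t) \<le> P2 (x (Suc t))"
    by (rule \<xi>_subgrad)
  have "ereal (p (Suc t)) + ereal (inner (v t) (x t - x (Suc t))) \<le> ereal (p t)"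
    using v_subgrad[of t] unfolding convex_subgrad_def P1_x[symmetric] by blast
  then have 4: "p (Suc t) + inner (v t) (x t - x (Suc t)) \<le> p t" by simp
  have 5: "inner (v t) (x t - x (Suc t)) = L * inner (y t - x (Suc t)) (x t - x (Suc t))
      + inner (grad f (y t)) (x (Suc t) - y t) - inner (grad f (y t)) (x t - y t)
      - inner (\<xi> t) (x (Suc t) - x t)"
    by (simp add: v_def inner_simps algebra_simps)
  have 6: "L / 2 * (norm (x t - y t))\<^sup>2 = L / 2 * (D t)\<^sup>2 + L / 2 * (norm (x (Suc t) - y t))\<^sup>2
      - L * inner (y t - x (Suc t)) (x t - x (Suc t))"
    unfolding D_def power2_norm_eq_inner
    by (simp add: inner_simps inner_commute algebra_simps)
  show ?thesis unfolding F_val_def using 1 2 3 4 5 6 by linarith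
qed

text \<open>Extrapolation moves the point by at most \<open>SUP t. \<beta> t\<close> times the last
  step, so the quadratic term of \<open>E\<close> pays for it and leaves the multiple
  \<open>H\<close>.\<close>

lemma E_descent_step: "E_val (Suc t) \<le> E_val t - H * (norm (x t - x (t - 1)))\<^sup>2"
proof -
  let ?d = "norm (x t - x (t - 1))" and ?B = "SUP t. \<beta> t"
  have "norm (x t - y t) = \<beta> t * ?d" using \<beta>_bounds(1)[of t] by (simp add: y_def)
  then have "norm (x t - y t) \<le> ?B * ?d"
    using \<beta>_bounds(2)[of t] by (simp add: mult_right_mono)
  then have "(norm (x t - y t))\<^sup>2 \<le> (?B * ?d)\<^sup>2" by (rule power_mono) simp
  then have "L / 2 * (norm (x t - y t))\<^sup>2 \<le> L / 2 * (?B\<^sup>2 * ?d\<^sup>2)"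
    using L by (simp add: power_mult_distrib)
  then show ?thesis using F_descent[of t]
    unfolding E_val_def H_def D_def by (simp add: algebra_simps)
qed

lemma E_descent: "H * (D t)\<^sup>2 \<le> E_val (Suc t) - E_val (Suc (Suc t))"
  using E_descent_step[of "Suc t"] by (simp add: D_def)

lemma E_val_decseq: "decseq E_val"
proof (rule decseq_SucI)
  fix t
  have "0 \<le> H * (norm (x t - x (t - 1)))\<^sup>2" using H_pos by simp
  then show "E_val (Suc t) \<le> E_val t" using E_descent_step[of t] by linarith
qed

lemma F_val_le_E_val: "F_val t \<le> E_val t"
  using L by (simp add: E_val_def)

text \<open>\<open>F\<close> stays below \<open>E_val 0\<close>, so all iterates lie in one bounded
  sublevel set.\<close>

lemma x_bounded: "bounded (range x)"
proof -
  have "bounded {z. objective_F f P1 P2 z \<le> ereal (E_val 0)}"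
    using F_level by (simp add: level_bounded_def)
  moreover have "range x \<subseteq> {z. objective_F f P1 P2 z \<le> ereal (E_val 0)}"
    using F_val_le_E_val decseqD[OF E_val_decseq, of 0] order_trans by (fastforce simp: F_x)
  ultimately show ?thesis by (rule bounded_subset)
qed

lemma f_cont: "continuous_on UNIV f"
  using f_diff by (auto simp: continuous_on_eq_continuous_at differentiable_imp_continuous_within)

lemma grad_f_cont: "continuous_on UNIV (grad f)"
  by (rule lipschitz_on_continuous_on[OF f_lip])

text \<open>The affine minorant of \<open>P1\<close> at \<open>x 1\<close> given by
  \<open>v 0\<close> replaces \<open>P1\<close> by a continuous function, which attains its infimum
  on the compact closure of the iterates.\<close>

lemma E_val_bounded_below: "\<exists>c. \<forall>t. c \<le> E_val t"
proof -
  let ?g = "\<lambda>z. f z + (p 1 + inner (v 0) (z - x 1)) - P2 z"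
  have "compact (closure (range x))" using x_bounded by simp
  moreover have "continuous_on (closure (range x)) ?g"
    using f_cont P2_cont by (intro continuous_intros) (auto intro: continuous_on_subset)
  moreover have "closure (range x) \<noteq> {}" by simp
  ultimately obtain w where w: "\<forall>z\<in>closure (range x). ?g w \<le> ?g z"
    using continuous_attains_inf[of "closure (range x)" ?g] by blast
  have "?g w \<le> E_val t" for t
  proof -
    have "ereal (p 1) + ereal (inner (v 0) (x t - x 1)) \<le> ereal (p t)"
      using v_subgrad[of 0] unfolding convex_subgrad_def P1_x[symmetric] by simp
    then have "p 1 + inner (v 0) (x t - x 1) \<le> p t" by simp
    then have "?g (x t) \<le> E_val t" using F_val_le_E_val[of t] unfolding F_val_def by linarith
    moreover have "x t \<in> closure (range x)" by (rule subsetD[OF closure_subset rangeI])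
    then have "?g w \<le> ?g (x t)" by (rule bspec[OF w])
    ultimately show ?thesis by linarith
  qed
  then show ?thesis by blast
qed

section \<open>Limits of the values and cluster points\<close>

definition "\<zeta> = lim E_val"

lemma E_val_lim: "E_val \<longlonglongrightarrow> \<zeta>"
proof -
  obtain c where c: "\<forall>t. c \<le> E_val t" using E_val_bounded_below by blast
  obtain l where "E_val \<longlonglongrightarrow> l" using decseq_convergent[OF E_val_decseq c] by blast
  then show ?thesis unfolding \<zeta>_def by (simp add: limI)
qed

lemma D_lim: "D \<longlonglongrightarrow> 0"
  by (rule increments_tendsto_0[where e = "\<lambda>t. E_val (Suc t)", OF H_pos E_descent LIMSEQ_Suc[OF E_val_lim]])
    (simp add: D_def)

lemma prev_diff_lim: "(\<lambda>t. x t - x (t - 1)) \<longlonglongrightarrow> 0"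
proof (rule LIMSEQ_imp_Suc)
  have "D = (\<lambda>t. norm (x (Suc t) - x (Suc t - 1)))" by (simp add: fun_eq_iff D_def)
  with D_lim have "(\<lambda>t. norm (x (Suc t) - x (Suc t - 1))) \<longlonglongrightarrow> 0" by (simp only:)
  then show "(\<lambda>t. x (Suc t) - x (Suc t - 1)) \<longlonglongrightarrow> 0" by (rule tendsto_norm_zero_cancel)
qed

lemma F_val_lim: "F_val \<longlonglongrightarrow> \<zeta>"
proof -
  have "(\<lambda>t. E_val t - L / 2 * (norm (x t - x (t - 1)))\<^sup>2) \<longlonglongrightarrow> \<zeta> - L / 2 * (norm (0::'a))\<^sup>2"
    using E_val_lim prev_diff_lim by (intro tendsto_intros)
  then show ?thesis by (simp add: E_val_def)
qed

text \<open>Boundedness of \<open>\<xi>\<close> yields a further subsequence along which the prox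
  subgradients converge. The subgradient inequalities then pass to the limit, although
  \<open>P1\<close> need not be continuous.\<close>

lemma cluster_point:
  assumes r: "strict_mono r" and z: "(x \<circ> r) \<longlonglongrightarrow> z"
  shows "P1 z = ereal (\<zeta> - f z + P2 z)"
    and "\<exists>u w. convex_subgrad P1 z u \<and> (\<forall>q. P2 z + inner w (q - z) \<le> P2 q) \<and> grad f z + u - w = 0"
proof -
  have "bounded (range \<xi>)"
    by (rule bounded_subgrads[OF P2_cont x_bounded \<xi>_subgrad])
  then have "bounded (range (\<xi> \<circ> r))"
    by (rule bounded_subset) auto
  then obtain w r' where r': "strict_mono r'" and w': "((\<xi> \<circ> r) \<circ> r') \<longlonglongrightarrow> w"
    using bounded_imp_convergent_subsequence by blast
  define s where "s = r \<circ> r'"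
  have s: "strict_mono s" unfolding s_def using r r' by (rule strict_mono_o)
  have w: "(\<lambda>k. \<xi> (s k)) \<longlonglongrightarrow> w" using w' by (simp add: s_def o_def)
  have xs: "(\<lambda>k. x (s k)) \<longlonglongrightarrow> z"
    using LIMSEQ_subseq_LIMSEQ[OF z r'] by (simp add: s_def o_def)
  have ds: "(\<lambda>k. x (s k) - x (s k - 1)) \<longlonglongrightarrow> 0"
    using LIMSEQ_subseq_LIMSEQ[OF prev_diff_lim s] by (simp add: o_def)
  have "(\<lambda>k. y (s k) - x (s k)) \<longlonglongrightarrow> 0"
    using tendsto_norm_zero[OF ds]
    by (rule Lim_null_comparison[rotated]) (intro always_eventually allI norm_y)
  from tendsto_add[OF this xs] have ys: "(\<lambda>k. y (s k)) \<longlonglongrightarrow> z" by simp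
  have "(\<lambda>k. x (Suc (s k)) - x (s k)) \<longlonglongrightarrow> 0"
    using LIMSEQ_subseq_LIMSEQ[OF D_lim s]
    by (intro tendsto_norm_zero_cancel[of "\<lambda>k. x (Suc (s k)) - x (s k)"]) (simp add: o_def D_def)
  from tendsto_add[OF this xs] have Xs: "(\<lambda>k. x (Suc (s k))) \<longlonglongrightarrow> z" by simp
  \<comment> \<open>The only possible limit of \<open>p\<close>, because \<open>f + p - P2\<close>
    tends to \<open>\<zeta>\<close>.\<close>
  define c where "c = \<zeta> - f z + P2 z"
  have Fs: "(\<lambda>k. F_val (Suc (s k))) \<longlonglongrightarrow> \<zeta>"
    using LIMSEQ_subseq_LIMSEQ[OF LIMSEQ_Suc[OF F_val_lim] s] by (simp add: o_def)
  have "(\<lambda>k. F_val (Suc (s k)) - f (x (Suc (s k))) + P2 (x (Suc (s k)))) \<longlonglongrightarrow> c"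
    unfolding c_def using Fs Xs f_cont P2_cont
    by (intro tendsto_intros continuous_on_tendsto_compose[of UNIV f]
        continuous_on_tendsto_compose[of UNIV P2]) auto
  then have ps: "(\<lambda>k. p (Suc (s k))) \<longlonglongrightarrow> c"
    by (simp add: F_val_def)
  have gs: "(\<lambda>k. grad f (y (s k))) \<longlonglongrightarrow> grad f z"
    using grad_f_cont ys by (rule continuous_on_tendsto_compose) auto
  define u where "u = w - grad f z"
  have "(\<lambda>k. v (s k)) \<longlonglongrightarrow> L *\<^sub>R (z - z) - (grad f z - w)"
    unfolding v_def using ys Xs gs w by (intro tendsto_intros)
  then have vs: "(\<lambda>k. v (s k)) \<longlonglongrightarrow> u" by (simp add: u_def)
  have "(\<lambda>k. P1 (x (Suc (s k)))) \<longlonglongrightarrow> ereal c"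
    unfolding P1_x using ps by (rule tendsto_ereal)
  then have le: "P1 z \<le> ereal c"
    by (rule closed_funD_sequentially[OF P1_closed Xs])
  \<comment> \<open>Serves twice: at \<open>q = z\<close> it complements \<open>le\<close> and fixes
    the value of \<open>P1 z\<close>; for general \<open>q\<close> it makes \<open>u\<close> a
    subgradient.\<close>
  have ge: "ereal (c + inner u (q - z)) \<le> P1 q" for q
  proof (rule tendsto_upperbound)
    show "(\<lambda>k. ereal (p (Suc (s k)) + inner (v (s k)) (q - x (Suc (s k))))) \<longlonglongrightarrow> ereal (c + inner u (q - z))"
      using ps vs Xs by (intro tendsto_intros)
    show "\<forall>\<^sub>F k in sequentially. ereal (p (Suc (s k)) + inner (v (s k)) (q - x (Suc (s k)))) \<le> P1 q"
      using v_subgrad by (simp add: convex_subgrad_def P1_x)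
  qed simp
  have P1z: "P1 z = ereal c" using le ge[of z] by (intro antisym) auto
  then show "P1 z = ereal (\<zeta> - f z + P2 z)" by (simp add: c_def)
  have "convex_subgrad P1 z u"
    using ge by (simp add: convex_subgrad_def P1z)
  moreover have "P2 z + inner w (q - z) \<le> P2 q" for q
  proof (rule LIMSEQ_le_const2)
    show "(\<lambda>k. P2 (x (s k)) + inner (\<xi> (s k)) (q - x (s k))) \<longlonglongrightarrow> P2 z + inner w (q - z)"
      using w xs P2_cont by (intro tendsto_intros continuous_on_tendsto_compose[of UNIV P2]) auto
  qed (use \<xi>_subgrad in blast)
  moreover have "grad f z + u - w = 0" by (simp add: u_def)
  ultimately show "\<exists>u w. convex_subgrad P1 z u \<and> (\<forall>q. P2 z + inner w (q - z) \<le> P2 q) \<and> grad f z + u - w = 0"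
    by blast
qed

lemma cluster_point_stationary:
  assumes "strict_mono r" and "(x \<circ> r) \<longlonglongrightarrow> z"
  shows "z \<in> stationary_points f P1 P2"
proof -
  obtain u w where "convex_subgrad P1 z u" and w: "\<forall>q. P2 z + inner w (q - z) \<le> P2 q"
    and 0: "grad f z + u - w = 0"
    using cluster_point(2)[OF assms] by blast
  then have "u \<in> subdiff P1 z" by (intro convex_subgrad_imp_subdiff)
  moreover have "w \<in> subdiff (\<lambda>z. ereal (P2 z)) z"
    using w by (intro convex_subgrad_imp_subdiff) (simp add: convex_subgrad_def)
  ultimately have "\<exists>u w. 0 = grad f z + u - w \<and> u \<in> subdiff P1 z \<and> w \<in> subdiff (\<lambda>z. ereal (P2 z)) z"
    using 0 by metis
  then show ?thesis by (simp add: stationary_points_def)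
qed

lemma cluster_point_E:
  assumes "strict_mono r" and "(x \<circ> r) \<longlonglongrightarrow> z"
  shows "E (z, z) = ereal \<zeta>"
  using cluster_point(1)[OF assms] by (simp add: objective_E_def)

lemma accumulation_points_pairs:
  "accumulation_points (\<lambda>t. (x t, x (t - 1))) = {(z, z) | z. z \<in> accumulation_points x}"
proof (intro set_eqI iffI)
  fix l assume "l \<in> accumulation_points (\<lambda>t. (x t, x (t - 1)))"
  then obtain r where r: "strict_mono r" and l: "(\<lambda>k. (x (r k), x (r k - 1))) \<longlonglongrightarrow> l"
    by (auto simp: accumulation_points_def o_def)
  have d: "(\<lambda>k. x (r k) - x (r k - 1)) \<longlonglongrightarrow> 0"
    using LIMSEQ_subseq_LIMSEQ[OF prev_diff_lim r] by (simp add: o_def)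
  have 1: "(\<lambda>k. x (r k)) \<longlonglongrightarrow> fst l" and 2: "(\<lambda>k. x (r k - 1)) \<longlonglongrightarrow> snd l"
    using tendsto_fst[OF l] tendsto_snd[OF l] by simp_all
  have "fst l - snd l = 0"
    using tendsto_diff[OF 1 2] d by (rule LIMSEQ_unique)
  moreover have "fst l \<in> accumulation_points x"
    using r 1 by (auto simp: accumulation_points_def o_def)
  ultimately show "l \<in> {(z, z) | z. z \<in> accumulation_points x}"
    by (cases l) auto
next
  fix l assume "l \<in> {(z, z) | z. z \<in> accumulation_points x}"
  then obtain z r where l: "l = (z, z)" and r: "strict_mono r" and z: "(\<lambda>k. x (r k)) \<longlonglongrightarrow> z"
    by (auto simp: accumulation_points_def o_def)
  have d: "(\<lambda>k. x (r k) - x (r k - 1)) \<longlonglongrightarrow> 0"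
    using LIMSEQ_subseq_LIMSEQ[OF prev_diff_lim r] by (simp add: o_def)
  have "(\<lambda>k. x (r k - 1)) \<longlonglongrightarrow> z" using tendsto_diff[OF z d] by simp
  then have "(\<lambda>k. (x (r k), x (r k - 1))) \<longlonglongrightarrow> l"
    unfolding l using z by (intro tendsto_Pair)
  then show "l \<in> accumulation_points (\<lambda>t. (x t, x (t - 1)))"
    using r by (auto simp: accumulation_points_def o_def)
qed

section \<open>Subgradients of \<open>E\<close> along the iterates\<close>

text \<open>\<open>E\<close> is a part \<open>?s\<close> differentiable at \<open>(a, b)\<close>
  plus \<open>P1\<close> of the first component, whose subgradient there is
  \<open>(u, 0)\<close>.\<close>

lemma E_subdiffI:
  assumes diff: "P2 differentiable (at a)" and u: "convex_subgrad P1 a u"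
  shows "(u + (grad f a - grad P2 a + L *\<^sub>R (a - b)), - (L *\<^sub>R (a - b))) \<in> subdiff E (a, b)"
proof -
  let ?s = "\<lambda>q::'a \<times> 'a. f (fst q) - P2 (fst q) + L / 2 * inner (fst q - snd q) (fst q - snd q)"
  let ?w = "(grad f a - grad P2 a + L *\<^sub>R (a - b), - (L *\<^sub>R (a - b)))"
  obtain c where c: "P1 a = ereal c" using u by (cases "P1 a") (auto simp: convex_subgrad_def)
  have comp: "((\<lambda>q. g (fst q)) has_derivative (\<lambda>h. inner (fst h) (grad g a))) (at (a, b))"
    if "g differentiable (at a)" for g :: "'a \<Rightarrow> real"
  proof -
    have "(g has_derivative (\<lambda>h. inner h (grad g a))) (at (fst (a, b)))"
      using GDERIV_grad[OF that] by (simp add: gderiv_def)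
    from has_derivative_compose[OF has_derivative_fst[OF has_derivative_ident] this]
    show ?thesis .
  qed
  have d: "((\<lambda>q. fst q - snd q) has_derivative (\<lambda>h. fst h - snd h)) (at (a, b))"
    by (intro has_derivative_diff has_derivative_fst has_derivative_snd has_derivative_ident)
  have "(?s has_derivative (\<lambda>h. inner (fst h) (grad f a) - inner (fst h) (grad P2 a)
      + L / 2 * (inner (fst (a, b) - snd (a, b)) (fst h - snd h) + inner (fst h - snd h) (fst (a, b) - snd (a, b)))))
      (at (a, b))"
    by (intro has_derivative_add has_derivative_diff comp f_diff diff
        has_derivative_mult_right has_derivative_inner d)
  moreover have "(\<lambda>h. inner (fst h) (grad f a) - inner (fst h) (grad P2 a)
      + L / 2 * (inner (fst (a, b) - snd (a, b)) (fst h - snd h) + inner (fst h - snd h) (fst (a, b) - snd (a, b))))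
      = (\<lambda>h. inner h ?w)"
    by (rule ext) (simp add: inner_prod_def inner_simps inner_commute algebra_simps)
  ultimately have "GDERIV ?s (a, b) :> ?w"
    unfolding gderiv_def by simp
  then have "(u, 0) + ?w \<in> frechet_subdiff E (a, b)"
  proof (rule frechet_subdiffI)
    show "\<bar>E (a, b)\<bar> \<noteq> \<infinity>" by (simp add: objective_E_def c)
    fix q :: "'a \<times> 'a"
    have "ereal (c + inner u (fst q - a)) \<le> P1 (fst q)"
      using u by (simp add: convex_subgrad_def c)
    then show "E (a, b) + ereal (?s q - ?s (a, b) + inner (u, 0) (q - (a, b))) \<le> E q"
      by (cases q; cases "P1 (fst q)") (auto simp: objective_E_def c power2_norm_eq_inner inner_prod_def)
  qed
  then show ?thesis using frechet_subdiff_subset_subdiff by fastforce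
qed

text \<open>Where \<open>P2\<close> is differentiable, \<open>\<xi>\<close> is its gradient.
  Inserting \<open>v\<close> then leaves only differences of gradients and of points, each
  controlled by the last two steps.\<close>

lemma E_subdiff_bound:
  assumes diff: "\<And>z. z \<in> S \<Longrightarrow> P2 differentiable (at z)" and lip: "C-lipschitz_on S (grad P2)"
    and mem: "x (Suc t) \<in> S" "x (Suc (Suc t)) \<in> S"
  shows "\<exists>w\<in>subdiff E (x (Suc (Suc t)), x (Suc t)). norm w \<le> (2 * L + C) * (D (Suc t) + D t)"
proof -
  let ?a = "x (Suc (Suc t))" and ?b = "x (Suc t)" and ?y = "y (Suc t)"
  have \<xi>: "\<xi> (Suc t) = grad P2 ?b"
    by (rule subgrad_eq_GDERIV[OF GDERIV_grad[OF diff[OF mem(1)]] \<xi>_subgrad])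
  let ?w1 = "L *\<^sub>R (?y - ?b) + (grad f ?a - grad f ?y) - (grad P2 ?a - grad P2 ?b)"
  let ?w2 = "- (L *\<^sub>R (?a - ?b))"
  have "(v (Suc t) + (grad f ?a - grad P2 ?a + L *\<^sub>R (?a - ?b)), ?w2) \<in> subdiff E (?a, ?b)"
    by (rule E_subdiffI[OF diff[OF mem(2)] v_subgrad])
  moreover have "v (Suc t) + (grad f ?a - grad P2 ?a + L *\<^sub>R (?a - ?b)) = ?w1"
    by (simp add: v_def \<xi> algebra_simps)
  ultimately have mem_w: "(?w1, ?w2) \<in> subdiff E (?a, ?b)" by simp
  have C: "0 \<le> C" using lip by (rule lipschitz_on_nonneg)
  have yb: "norm (?y - ?b) \<le> D t" using norm_y[of "Suc t"] by (simp add: D_def)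
  have ab: "norm (?a - ?b) = D (Suc t)" by (simp add: D_def)
  have ay: "norm (?a - ?y) \<le> D (Suc t) + D t"
    using norm_triangle_ineq4[of "?a - ?b" "?y - ?b"] yb ab by simp
  have "norm ?w1 \<le> norm (L *\<^sub>R (?y - ?b)) + norm (grad f ?a - grad f ?y) + norm (grad P2 ?a - grad P2 ?b)"
    by (intro order_trans[OF norm_triangle_ineq4] add_right_mono norm_triangle_ineq)
  also have "\<dots> \<le> L * D t + L * (D (Suc t) + D t) + C * D (Suc t)"
  proof (intro add_mono)
    show "norm (L *\<^sub>R (?y - ?b)) \<le> L * D t" using yb L by simp
    have "norm (grad f ?a - grad f ?y) \<le> L * norm (?a - ?y)"
      using lipschitz_onD[OF f_lip, of ?a ?y] by (simp add: dist_norm)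
    also have "\<dots> \<le> L * (D (Suc t) + D t)" using ay L by (intro mult_left_mono) auto
    finally show "norm (grad f ?a - grad f ?y) \<le> L * (D (Suc t) + D t)" .
    show "norm (grad P2 ?a - grad P2 ?b) \<le> C * D (Suc t)"
      using lipschitz_onD[OF lip mem(2,1)] by (simp add: dist_norm D_def)
  qed
  finally have "norm ?w1 \<le> L * D t + L * (D (Suc t) + D t) + C * D (Suc t)" .
  moreover have "norm ?w2 = L * D (Suc t)" using L by (simp add: D_def)
  ultimately have "norm (?w1, ?w2) \<le> L * D t + L * (D (Suc t) + D t) + C * D (Suc t) + L * D (Suc t)"
    using norm_Pair_le[of ?w1 ?w2] by linarith
  also have "\<dots> \<le> (2 * L + C) * (D (Suc t) + D t)"
    using mult_nonneg_nonneg[OF C, of "D t"] by (simp add: D_def algebra_simps)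
  finally show ?thesis using mem_w by blast
qed

section \<open>Convergence of the whole sequence\<close>

lemma convergence:
  assumes N0: "open N0" "stationary_points f P1 P2 \<subseteq> N0"
    and P2_diff: "continuously_differentiable_on P2 N0"
    and P2_lip: "locally_lipschitz_on N0 (grad P2)"
    and KL: "KL_function E"
  shows "summable D"
    and "\<exists>z\<in>stationary_points f P1 P2. x \<longlonglongrightarrow> z"
    and "(\<lambda>t. edist 0 (subdiff E (x t, x (t - 1)))) \<longlonglongrightarrow> 0"
proof -
  obtain z r where r: "strict_mono r" and z: "(x \<circ> r) \<longlonglongrightarrow> z"
    using bounded_imp_convergent_subsequence[OF x_bounded] by blast
  have stat: "z \<in> stationary_points f P1 P2" by (rule cluster_point_stationary[OF r z])
  then have zN: "z \<in> N0" using N0 by blast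
  have diff: "P2 differentiable (at q)" if "q \<in> N0" for q
    using P2_diff that by (simp add: continuously_differentiable_on_def)
  obtain \<epsilon> C where \<epsilon>: "0 < \<epsilon>" and lip: "C-lipschitz_on (ball z \<epsilon> \<inter> N0) (grad P2)"
    using P2_lip zN unfolding locally_lipschitz_on_def by blast
  have "open (ball z \<epsilon> \<inter> N0)" "z \<in> ball z \<epsilon> \<inter> N0" using N0 zN \<epsilon> by auto
  then obtain \<rho> where \<rho>: "0 < \<rho>" "ball z \<rho> \<subseteq> ball z \<epsilon> \<inter> N0"
    using open_contains_ball by blast
  have bound: "\<exists>w\<in>subdiff E (x (Suc (Suc t)), x (Suc t)). norm w \<le> (2 * L + C) * (D (Suc t) + D t)"
    if "x (Suc t) \<in> ball z \<rho>" "x (Suc (Suc t)) \<in> ball z \<rho>" for t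
    by (rule E_subdiff_bound[OF _ lip]) (use diff \<rho>(2) that in auto)
  obtain u where "convex_subgrad P1 z u" using cluster_point(2)[OF r z] by blast
  \<comment> \<open>\<open>KL_function\<close> gives the inequality only at points with a nonempty
    subdifferential.\<close>
  then have "(z, z) \<in> dom_subdiff E"
    unfolding dom_subdiff_def using E_subdiffI[OF diff[OF zN], of u z] by blast
  then have KLz: "KL_property_at E (z, z)" using KL by (simp add: KL_function_def)
  have "(\<lambda>t. E_val (Suc t) - \<zeta>) \<longlonglongrightarrow> \<zeta> - \<zeta>"
    using LIMSEQ_Suc[OF E_val_lim] by (intro tendsto_intros)
  then have e_lim: "(\<lambda>t. E_val (Suc t) - \<zeta>) \<longlonglongrightarrow> 0" by simp
  have he: "E (x (Suc t), x t) = ereal (\<zeta> + (E_val (Suc t) - \<zeta>))" for t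
    using E_x[of "Suc t"] by simp
  have desc: "H * (D t)\<^sup>2 \<le> E_val (Suc t) - \<zeta> - (E_val (Suc (Suc t)) - \<zeta>)" for t
    using E_descent[of t] by simp
  have bound': "\<exists>w\<in>subdiff E (x (Suc (Suc t)), x (Suc t)).
      norm w \<le> (2 * L + C) * (norm (x (Suc (Suc t)) - x (Suc t)) + norm (x (Suc t) - x t))"
    if "x t \<in> ball z \<rho>" "x (Suc t) \<in> ball z \<rho>" "x (Suc (Suc t)) \<in> ball z \<rho>" for t
    using bound[OF that(2,3)] by (simp only: D_def)
  note len = KL_finite_length[where e = "\<lambda>t. E_val (Suc t) - \<zeta>" and H = H and \<rho> = \<rho> and C = "2 * L + C",
      OF KLz cluster_point_E[OF r z] he H_pos desc[unfolded D_def] e_lim \<rho>(1) bound' r z]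
  have "D = (\<lambda>t. norm (x (Suc t) - x t))" by (simp add: fun_eq_iff D_def)
  then show "summable D"
    using len(1) by (simp only:)
  have lim: "x \<longlonglongrightarrow> z"
    by (rule len(2))
  then show "\<exists>z\<in>stationary_points f P1 P2. x \<longlonglongrightarrow> z" using stat by blast
  show "(\<lambda>t. edist 0 (subdiff E (x t, x (t - 1)))) \<longlonglongrightarrow> 0"
  \<comment> \<open>The subgradient bound involves two earlier steps, so it starts at index
    2.\<close>
  proof (rule LIMSEQ_offset[where k = 2])
    let ?b = "\<lambda>t. (2 * L + C) * (D (Suc t) + D t)"
    have "\<forall>\<^sub>F t in sequentially. x t \<in> ball z \<rho>"
      by (rule topological_tendstoD[OF lim]) (use \<rho>(1) in auto)
    then obtain T where T: "\<And>t. T \<le> t \<Longrightarrow> x t \<in> ball z \<rho>"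
      unfolding eventually_sequentially by blast
    show "(\<lambda>t. edist 0 (subdiff E (x (t + 2), x (t + 2 - 1)))) \<longlonglongrightarrow> 0"
    proof (rule tendsto_sandwich[OF _ _ tendsto_const])
      show "\<forall>\<^sub>F t in sequentially. edist 0 (subdiff E (x (t + 2), x (t + 2 - 1))) \<le> ereal (?b t)"
      proof (rule eventually_sequentiallyI)
        fix t assume "T \<le> t"
        then obtain w where w: "w \<in> subdiff E (x (Suc (Suc t)), x (Suc t))" "norm w \<le> ?b t"
          using bound[of t] T by auto
        have "edist 0 (subdiff E (x (Suc (Suc t)), x (Suc t))) \<le> ereal (norm w)"
          using edist_le[OF w(1), of 0] by simp
        also have "\<dots> \<le> ereal (?b t)" using w(2) by simp
        finally show "edist 0 (subdiff E (x (t + 2), x (t + 2 - 1))) \<le> ereal (?b t)" by simp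
      qed
      have "(\<lambda>t. ereal (?b t)) \<longlonglongrightarrow> ereal ((2 * L + C) * (0 + 0))"
        using D_lim LIMSEQ_Suc[OF D_lim] by (intro tendsto_intros)
      then show "(\<lambda>t. ereal (?b t)) \<longlonglongrightarrow> 0" by (simp add: zero_ereal_def)
    qed (simp add: edist_nonneg)
  qed
qed

end

theorem theorem4p2:
  fixes f P2 :: "real ^ 'n \<Rightarrow> real"
    and P1 :: "real ^ 'n \<Rightarrow> ereal"
    and L :: real
    and \<beta> :: "nat \<Rightarrow> real"
    and x :: "nat \<Rightarrow> real ^ 'n"
    and N0 :: "(real ^ 'n) set"
  assumes "0 < L"
    and "convex_on UNIV f"
    and "\<forall>z. f differentiable (at z)"
    and "L-lipschitz_on UNIV (grad f)"
    and "proper_fun P1" and "closed_fun P1" and "convex_fun P1"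
    and "continuous_on UNIV P2" and "convex_on UNIV P2"
    and "level_bounded (objective_F f P1 P2)"
    and "open N0" and "stationary_points f P1 P2 \<subseteq> N0"
    and "continuously_differentiable_on P2 N0"
    and "locally_lipschitz_on N0 (grad P2)"
    and "KL_function (objective_E f P1 P2 L)"
    and "pDCAe_sequence f P1 P2 L \<beta> x"
  shows "\<exists>\<zeta>::real.
      (\<lambda>t. objective_F f P1 P2 (x t)) \<longlonglongrightarrow> ereal \<zeta> \<and>
      \<comment> \<open>(i)\<close>
      (\<lambda>t. edist (0, 0) (subdiff (objective_E f P1 P2 L) (x t, x (t - 1)))) \<longlonglongrightarrow> 0 \<and>
      \<comment> \<open>(ii)\<close>
      decseq (\<lambda>t. objective_E f P1 P2 L (x t, x (t - 1))) \<and>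
      (\<lambda>t. objective_E f P1 P2 L (x t, x (t - 1))) \<longlonglongrightarrow> ereal \<zeta> \<and>
      \<comment> \<open>(iii)\<close>
      accumulation_points (\<lambda>t. (x t, x (t - 1))) = {(z, z) | z. z \<in> accumulation_points x} \<and>
      (\<forall>p\<in>{(z, z) | z. z \<in> accumulation_points x}. objective_E f P1 P2 L p = ereal \<zeta>) \<and>
      \<comment> \<open>(iv)\<close>
      (\<exists>xbar\<in>stationary_points f P1 P2. x \<longlonglongrightarrow> xbar) \<and>
      summable (\<lambda>t. norm (x (Suc t) - x t))"
proof -
  interpret pDCAe f P2 P1 L \<beta> x
    using assms by unfold_locales auto
  note conv = convergence[OF assms(11-15)]
  have "(\<lambda>t. objective_F f P1 P2 (x t)) \<longlonglongrightarrow> ereal \<zeta>"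
    using F_val_lim by (simp add: F_x)
  moreover have "(\<lambda>t. edist (0, 0) (subdiff (objective_E f P1 P2 L) (x t, x (t - 1)))) \<longlonglongrightarrow> 0"
    using conv(3) by (simp add: zero_prod_def)
  moreover have "decseq (\<lambda>t. objective_E f P1 P2 L (x t, x (t - 1)))"
    unfolding E_x using E_val_decseq by (simp add: decseq_def)
  moreover have "(\<lambda>t. objective_E f P1 P2 L (x t, x (t - 1))) \<longlonglongrightarrow> ereal \<zeta>"
    unfolding E_x using E_val_lim by simp
  moreover note accumulation_points_pairs
  moreover have "\<forall>p\<in>{(z, z) | z. z \<in> accumulation_points x}. objective_E f P1 P2 L p = ereal \<zeta>"
    using cluster_point_E by (auto simp: accumulation_points_def)
  moreover note conv(2)
  moreover have "summable (\<lambda>t. norm (x (Suc t) - x t))"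
    using conv(1) by (simp add: D_def[abs_def])
  ultimately show ?thesis by (intro exI[of _ \<zeta>] conjI)
qed

end
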